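(* Let $m,n$ be relatively prime positive integers and let $\Delta(t) \in \mathbb{Z}[t]$ be a primitive polynomial. Then $\Delta(t)$ has the $mn$-Hartley condition if and only if it has both the $m$-Hartley condition and the $n$-Hartley condition.
   Context: Let $\zeta_n = \exp(2\pi i/n)$. A polynomial $\Delta(t) \in \mathbb{Z}[t]$ has the $n$-Hartley condition if there exists $g(t) \in \mathbb{Z}[t]$ with $\Delta(t^n) = \pm \prod_{j=0}^{n-1} g(\zeta_n^j t)$. A polynomial in $\mathbb{Z}[t]$ is primitive if no prime divides all its coefficients. *)

theory Defs
  imports "HOL-Analysis.Analysis" "HOL-Computational_Algebra.Computational_Algebra"
begin

definition zeta :: "nat \<Rightarrow> complex" where
  "zeta n = exp (2 * of_real pi * \<i> / of_nat n)"

definition hartley :: "nat \<Rightarrow> int poly \<Rightarrow> bool" where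
  "hartley n D \<longleftrightarrow> (\<exists>g :: int poly. \<exists>s :: complex. (s = 1 \<or> s = -1) \<and>
      pcompose (map_poly of_int D) (monom 1 n) =
      smult s (\<Prod>j<n. pcompose (map_poly of_int g) [:0, zeta n ^ j:]))"

definition primitive_int_poly :: "int poly \<Rightarrow> bool" where
  "primitive_int_poly D \<longleftrightarrow> (\<forall>p::int. prime p \<longrightarrow> \<not> (\<forall>i. p dvd coeff D i))"

end

theory Submission
  imports Defs "Jordan_Normal_Form.Char_Poly"
begin

hide_const (open) module.smult

text \<open>
  Let \<open>root_norm n g\<close> be the norm from \<open>\<int>[t]\<close> to \<open>\<int>[t ^ n]\<close>, so that \<open>D\<close> has the \<open>n\<close>-Hartley condition iff
  \<open>D = \<plusminus> root_norm n g\<close> for some \<open>g\<close>. These norms are multiplicative and compose, which gives one direction.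
  For the other, let \<open>P\<close> be an irreducible factor of \<open>D\<close> with root \<open>a \<noteq> 0\<close>. An irreducible \<open>Q\<close> with root \<open>b\<close>,
  \<open>b ^ n = a\<close>, has norm \<open>\<plusminus> P ^ s\<close> where \<open>s\<close> is the degree of \<open>\<rat>(b)\<close> over \<open>\<rat>(a)\<close>. Hence everything follows if among
  these degrees there is one, \<open>d n\<close>, that divides all the others and has only prime factors of \<open>n\<close>: then the
  \<open>n\<close>-Hartley condition says that \<open>d n\<close> divides the multiplicity of \<open>P\<close> in \<open>D\<close>, and for coprime \<open>m\<close> and \<open>n\<close> the
  \<open>m n\<close>-th root of \<open>a\<close> made from minimal roots has degree \<open>d m * d n\<close>.

  This also reduces the existence of \<open>d n\<close> to \<open>n = p ^ k\<close>. For \<open>p = 2\<close> all degrees are powers of \<open>2\<close>. For odd \<open>p\<close>,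
  if \<open>p ^ g\<close> exactly divides one of the degrees, then by taking norms \<open>a\<close> is a \<open>p ^ (k - g)\<close>-th power \<open>c ^ p ^ (k - g)\<close>
  in \<open>\<rat>(a)\<close>; for the least \<open>g\<close>, any \<open>p ^ g\<close>-th root of \<open>c\<close> is a root of degree exactly \<open>p ^ g\<close>.
\<close>

section \<open>Norms of integer polynomials\<close>

definition ev :: "int poly \<Rightarrow> complex \<Rightarrow> complex" where
  "ev f z = poly (map_poly of_int f) z"

lemma ev_add [simp]: "ev (f + g) z = ev f z + ev g z"
  and ev_diff [simp]: "ev (f - g) z = ev f z - ev g z"
  and ev_uminus [simp]: "ev (- f) z = - ev f z"
  and ev_mult [simp]: "ev (f * g) z = ev f z * ev g z"
  and ev_power [simp]: "ev (f ^ k) z = ev f z ^ k"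
  and ev_0 [simp]: "ev 0 z = 0"
  and ev_1 [simp]: "ev 1 z = 1"
  and ev_const [simp]: "ev [:c:] z = of_int c"
  and ev_smult [simp]: "ev (smult c f) z = of_int c * ev f z"
  and ev_pCons [simp]: "ev (pCons c f) z = of_int c + z * ev f z"
  and ev_monom [simp]: "ev (monom c k) z = of_int c * z ^ k"
  by (simp_all add: ev_def hom_distribs poly_monom map_poly_monom of_int_hom.map_poly_pCons_hom)

lemma comm_ring_hom_ev: "comm_ring_hom (\<lambda>f. ev f z)"
  by unfold_locales auto

lemma ev_sum: "ev (\<Sum>i\<in>A. f i) z = (\<Sum>i\<in>A. ev (f i) z)"
  by (induction A rule: infinite_finite_induct) auto

lemma ev_pcompose [simp]: "ev (pcompose f g) z = ev f (ev g z)"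
  by (induction f) (auto simp: pcompose_pCons)

lemma ev_altdef: "ev f z = (\<Sum>e\<le>degree f. of_int (coeff f e) * z ^ e)"
  by (simp add: ev_def poly_altdef)

lemma finite_ev_roots: "f \<noteq> 0 \<Longrightarrow> finite {z. ev f z = 0}"
  unfolding ev_def by (rule poly_roots_finite) simp

text \<open>A nonzero difference has finitely many roots. The point 0 is left out because it has one
  \<open>n\<close>-th root instead of \<open>n\<close>, so products over the set of roots compute
  norms only elsewhere.\<close>

lemma complex_poly_eqI:
  fixes p q :: "complex poly"
  assumes "\<And>z. z \<noteq> 0 \<Longrightarrow> poly p z = poly q z"
  shows "p = q"
proof (rule ccontr)
  assume "p \<noteq> q"
  then have "finite {z. poly (p - q) z = 0}"
    by (intro poly_roots_finite) simp
  moreover have "UNIV - {0} \<subseteq> {z. poly (p - q) z = 0}"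
    using assms by auto
  ultimately have "finite (UNIV - {0::complex})"
    using finite_subset by blast
  then show False
    by (simp add: infinite_UNIV_char_0)
qed

lemma ev_eqI: "(\<And>z. z \<noteq> 0 \<Longrightarrow> ev f z = ev g z) \<Longrightarrow> f = g"
  using complex_poly_eqI[of "map_poly of_int f" "map_poly of_int g"] by (simp add: ev_def)

text \<open>The matrix of multiplication by \<open>g y\<close> on the basis \<open>1, y, \<dots>, y ^ (n - 1)\<close>, where \<open>y ^ n = x\<close> and
  \<open>x\<close> is the variable of the entries.\<close>

definition mult_entry :: "nat \<Rightarrow> int poly \<Rightarrow> nat \<Rightarrow> nat \<Rightarrow> int poly" where
  "mult_entry n g i k = (\<Sum>e\<le>degree g. if (e + i) mod n = k then monom (coeff g e) ((e + i) div n) else 0)"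

text \<open>A determinant instead of a product over conjugates, so that integrality of the
  coefficients is built in.\<close>

definition root_norm :: "nat \<Rightarrow> int poly \<Rightarrow> int poly" where
  "root_norm n g = Determinant.det (Matrix.mat n n (\<lambda>(i, k). mult_entry n g i k))"

text \<open>Reducing the exponents in \<open>y ^ i * ev g y\<close> by \<open>y ^ n = x\<close>
  yields row \<open>i\<close> of the matrix. So the powers of \<open>y\<close> form an eigenvector
  with eigenvalue \<open>ev g y\<close>.\<close>

lemma mult_entry_eigen:
  assumes "n > 0" "y ^ n = x"
  shows "(\<Sum>k<n. ev (mult_entry n g i k) x * y ^ k) = y ^ i * ev g y"
proof -
  have "(\<Sum>k<n. ev (mult_entry n g i k) x * y ^ k) =
      (\<Sum>k<n. \<Sum>e\<le>degree g. if (e + i) mod n = k then of_int (coeff g e) * x ^ ((e + i) div n) * y ^ k else 0)"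
    by (auto simp: mult_entry_def ev_sum sum_distrib_right intro!: sum.cong)
  also have "\<dots> = (\<Sum>e\<le>degree g. \<Sum>k<n. if (e + i) mod n = k then of_int (coeff g e) * x ^ ((e + i) div n) * y ^ k else 0)"
    by (rule sum.swap)
  also have "\<dots> = (\<Sum>e\<le>degree g. of_int (coeff g e) * x ^ ((e + i) div n) * y ^ ((e + i) mod n))"
    using assms by (intro sum.cong) (auto simp: sum.delta)
  also have "\<dots> = (\<Sum>e\<le>degree g. of_int (coeff g e) * y ^ (e + i))"
  proof (intro sum.cong refl)
    fix e
    have "x ^ ((e + i) div n) * y ^ ((e + i) mod n) = y ^ (n * ((e + i) div n) + (e + i) mod n)"
      by (simp only: power_add power_mult assms)
    then show "of_int (coeff g e) * x ^ ((e + i) div n) * y ^ ((e + i) mod n) = of_int (coeff g e) * y ^ (e + i)"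
      by (simp add: mult.assoc)
  qed
  also have "\<dots> = y ^ i * ev g y"
    by (simp add: ev_altdef power_add sum_distrib_left mult_ac)
  finally show ?thesis .
qed

text \<open>The eigenvectors for the \<open>n\<close> distinct roots \<open>y\<close> form a
  Vandermonde matrix that diagonalizes, so the determinant is the product of the
  eigenvalues.\<close>

lemma ev_root_norm:
  assumes "n > 0" "x \<noteq> 0"
  shows "ev (root_norm n g) x = (\<Prod>y\<in>{y. y ^ n = x}. ev g y)"
proof -
  have fin: "finite {y. y ^ n = x}" and card: "card {y. y ^ n = x} = n"
    using assms by (auto simp: finite_nth_roots card_nth_roots)
  then obtain y where y: "bij_betw y {0..<n} {y. y ^ n = x}"
    by (metis ex_bij_betw_nat_finite)
  have yn: "y j ^ n = x" if "j < n" for j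
    using y that by (auto simp: bij_betw_def)
  define A where "A = Matrix.mat n n (\<lambda>(i, k). mult_entry n g i k)"
  define A' where "A' = map_mat (\<lambda>f. ev f x) A"
  define B where "B = Matrix.mat n n (\<lambda>(k, j). y j ^ k)"
  define C where "C = Matrix.mat n n (\<lambda>(i, j). if i = j then ev g (y j) else 0)"
  have dims: "A' \<in> carrier_mat n n" "B \<in> carrier_mat n n" "C \<in> carrier_mat n n"
    by (auto simp: A_def A'_def B_def C_def)
  have "A' * B = B * C"
  proof (rule eq_matI)
    fix i j assume "i < dim_row (B * C)" "j < dim_col (B * C)"
    then have ij: "i < n" "j < n"
      by (auto simp: B_def C_def)
    have "(A' * B) $$ (i, j) = (\<Sum>k<n. ev (mult_entry n g i k) x * y j ^ k)"
      using ij by (auto simp: A'_def A_def B_def scalar_prod_def lessThan_atLeast0 intro!: sum.cong)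
    also have "\<dots> = y j ^ i * ev g (y j)"
      using assms yn ij by (intro mult_entry_eigen) auto
    also have "\<dots> = (\<Sum>k\<in>{0..<n}. y k ^ i * (if k = j then ev g (y j) else 0))"
      using ij by (simp add: if_distrib[of "(*) _"] cong: if_cong)
    also have "\<dots> = (B * C) $$ (i, j)"
      using ij by (auto simp: B_def C_def scalar_prod_def intro!: sum.cong)
    finally show "(A' * B) $$ (i, j) = (B * C) $$ (i, j)" .
  qed (auto simp: A_def A'_def B_def C_def)
  then have "Determinant.det A' * Determinant.det B = Determinant.det B * Determinant.det C"
    using dims by (metis det_mult)
  \<comment> \<open>A kernel vector of the transpose holds the coefficients of a polynomial of
    degree below \<open>n\<close> with \<open>n\<close> roots.\<close>
  moreover have "Determinant.det B \<noteq> 0"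
  proof
    assume "Determinant.det B = 0"
    then have "Determinant.det (transpose_mat B) = 0"
      using dims by (simp add: det_transpose)
    then obtain v where v: "v \<in> carrier_vec n" "v \<noteq> 0\<^sub>v n" "transpose_mat B *\<^sub>v v = 0\<^sub>v n"
      using det_0_iff_vec_prod_zero[of "transpose_mat B" n] dims by auto
    define p where "p = (\<Sum>k<n. monom (vec_index v k) k)"
    have cp: "coeff p k = (if k < n then vec_index v k else 0)" for k
      by (auto simp: p_def coeff_sum)
    have "p = 0"
    proof (rule ccontr)
      assume "p \<noteq> 0"
      have root: "poly p (y j) = 0" if "j < n" for j
      proof -
        have "vec_index (transpose_mat B *\<^sub>v v) j = 0"
          using v that by simp
        then show ?thesis
          using that v(1) by (simp add: p_def poly_sum poly_monom B_def scalar_prod_def lessThan_atLeast0 mult.commute)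
      qed
      have "{y. y ^ n = x} \<subseteq> {z. poly p z = 0}"
      proof
        fix w assume "w \<in> {y. y ^ n = x}"
        then obtain j where "j < n" "w = y j"
          using y unfolding bij_betw_def by (metis atLeastLessThan_iff imageE)
        then show "w \<in> {z. poly p z = 0}"
          using root by simp
      qed
      then have "n \<le> card {z. poly p z = 0}"
        using card_mono[OF poly_roots_finite[OF \<open>p \<noteq> 0\<close>]] card by metis
      also have "\<dots> \<le> degree p"
        by (rule card_poly_roots_bound) fact
      also have "degree p < n"
        using \<open>p \<noteq> 0\<close> cp by (metis leading_coeff_0_iff)
      finally show False by simp
    qed
    then have "vec_index v k = 0" if "k < n" for k
      using cp[of k] that by simp
    then have "v = 0\<^sub>v n"
      using v(1) by (intro eq_vecI) auto
    with v show False by simp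
  qed
  ultimately have "Determinant.det A' = Determinant.det C"
    by simp
  also have "\<dots> = prod_list (diag_mat C)"
    using dims by (intro det_upper_triangular[of _ n]) (auto simp: C_def)
  also have "\<dots> = (\<Prod>j\<in>{0..<n}. ev g (y j))"
    by (simp add: prod_list_diag_prod C_def)
  also have "\<dots> = (\<Prod>y\<in>{y. y ^ n = x}. ev g y)"
    by (rule prod.reindex_bij_betw[OF y])
  also have "Determinant.det A' = ev (root_norm n g) x"
    using comm_ring_hom.hom_det[OF comm_ring_hom_ev] by (simp add: A'_def A_def root_norm_def)
  finally show ?thesis .
qed

lemma root_norm_mult:
  assumes "n > 0"
  shows "root_norm n (f * g) = root_norm n f * root_norm n g"
  by (rule ev_eqI) (use assms in \<open>simp add: ev_root_norm prod.distrib\<close>)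

lemma root_norm_1 [simp]: "n > 0 \<Longrightarrow> root_norm n 1 = 1"
  by (rule ev_eqI) (simp add: ev_root_norm)

lemma root_norm_const: "n > 0 \<Longrightarrow> root_norm n [:c:] = [:c ^ n:]"
  by (rule ev_eqI) (simp add: ev_root_norm card_nth_roots)

text \<open>The map from \<open>z\<close> to \<open>z ^ n\<close> sorts the \<open>m * n\<close>-th
  roots of \<open>x\<close> into the \<open>n\<close>-th roots of each \<open>m\<close>-th
  root.\<close>

lemma root_norm_root_norm:
  assumes "m > 0" "n > 0"
  shows "root_norm m (root_norm n g) = root_norm (m * n) g"
proof (rule ev_eqI)
  fix x :: complex assume "x \<noteq> 0"
  have nz: "y \<noteq> 0" if "y ^ m = x" for y
    using that \<open>x \<noteq> 0\<close> assms by auto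
  have "ev (root_norm m (root_norm n g)) x = (\<Prod>y\<in>{y. y ^ m = x}. \<Prod>z\<in>{z. z ^ n = y}. ev g z)"
    using assms \<open>x \<noteq> 0\<close> nz by (simp add: ev_root_norm)
  also have "\<dots> = (\<Prod>(y, z)\<in>Sigma {y. y ^ m = x} (\<lambda>y. {z. z ^ n = y}). ev g z)"
    using assms by (intro prod.Sigma) auto
  also have "\<dots> = (\<Prod>z\<in>{z. z ^ (m * n) = x}. ev g z)"
    by (rule prod.reindex_bij_witness[of _ "\<lambda>z. (z ^ n, z)" snd])
      (auto simp: mult.commute[of m n] power_mult)
  also have "\<dots> = ev (root_norm (m * n) g) x"
    using assms \<open>x \<noteq> 0\<close> by (simp add: ev_root_norm)
  finally show "ev (root_norm m (root_norm n g)) x = ev (root_norm (m * n) g) x" .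
qed

section \<open>Translation of the Hartley condition into norms\<close>

lemma prod_zeta_mult:
  fixes F :: "complex \<Rightarrow> complex"
  assumes "n > 0" "z \<noteq> 0"
  shows "(\<Prod>j<n. F (zeta n ^ j * z)) = (\<Prod>y\<in>{y. y ^ n = z ^ n}. F y)"
proof (rule prod.reindex_bij_betw)
  have "zeta n ^ j = cis (2 * pi * real j / real n)" for j
    by (simp add: zeta_def cis_conv_exp exp_of_nat_mult[symmetric] mult_ac)
  then have "bij_betw (\<lambda>j. zeta n ^ j) {..<n} {w. w ^ n = 1}"
    using Complex.bij_betw_roots_unity[OF assms(1)] by simp
  moreover have "bij_betw (\<lambda>w. w * z) {w. w ^ n = 1} {y. y ^ n = z ^ n}"
    using assms by (intro bij_betwI[of _ _ _ "\<lambda>y. y / z"]) (auto simp: power_mult_distrib power_divide)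
  ultimately show "bij_betw (\<lambda>j. zeta n ^ j * z) {..<n} {y. y ^ n = z ^ n}"
    using bij_betw_trans[of "\<lambda>j. zeta n ^ j" "{..<n}" _ "\<lambda>w. w * z"] by (simp add: o_def)
qed

text \<open>At a nonzero \<open>z\<close>, both sides of the Hartley equation depend on
  \<open>z ^ n\<close> only. Every nonzero \<open>x\<close> is such a power, so the identity
  descends from \<open>z\<close> to \<open>x\<close>.\<close>

lemma hartley_iff_root_norm:
  assumes "n > 0"
  shows "hartley n D \<longleftrightarrow> (\<exists>g. D = root_norm n g \<or> D = - root_norm n g)"
proof -
  have lhs: "poly (pcompose (map_poly of_int D) (monom 1 n)) z = ev D (z ^ n)" for z :: complex
    by (simp add: poly_pcompose poly_monom ev_def)
  have rhs: "poly (\<Prod>j<n. pcompose (map_poly of_int g) [:0, zeta n ^ j:]) z = ev (root_norm n g) (z ^ n)"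
    if "z \<noteq> 0" for g z
  proof -
    have "z ^ n \<noteq> 0"
      using that by simp
    then have "ev (root_norm n g) (z ^ n) = (\<Prod>j<n. ev g (zeta n ^ j * z))"
      unfolding prod_zeta_mult[OF assms that] by (rule ev_root_norm[OF assms])
    then show ?thesis
      by (simp add: poly_prod poly_pcompose ev_def mult.commute)
  qed
  have *: "pcompose (map_poly of_int D) (monom 1 n) =
      smult s (\<Prod>j<n. pcompose (map_poly of_int g) [:0, zeta n ^ j:]) \<longleftrightarrow>
      (\<forall>x. x \<noteq> 0 \<longrightarrow> ev D x = s * ev (root_norm n g) x)" (is "?L = ?R \<longleftrightarrow> _") for s g
  proof
    assume eq: "?L = ?R"
    show "\<forall>x. x \<noteq> 0 \<longrightarrow> ev D x = s * ev (root_norm n g) x"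
    proof (intro allI impI)
      fix x :: complex assume "x \<noteq> 0"
      obtain z where z: "z ^ n = x"
        using nth_root_exists[of n x] assms by auto
      with \<open>x \<noteq> 0\<close> assms have "z \<noteq> 0"
        by auto
      with arg_cong[OF eq, of "\<lambda>p. poly p z"] z show "ev D x = s * ev (root_norm n g) x"
        by (simp add: lhs rhs)
    qed
  next
    assume eq: "\<forall>x. x \<noteq> 0 \<longrightarrow> ev D x = s * ev (root_norm n g) x"
    then show "?L = ?R"
      by (intro complex_poly_eqI) (simp add: lhs rhs)
  qed
  have "(\<forall>x. x \<noteq> 0 \<longrightarrow> ev D x = 1 * ev (root_norm n g) x) \<longleftrightarrow> D = root_norm n g" for g
    using ev_eqI[of D "root_norm n g"] by auto
  moreover have "(\<forall>x. x \<noteq> 0 \<longrightarrow> ev D x = -1 * ev (root_norm n g) x) \<longleftrightarrow> D = - root_norm n g" for g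
    using ev_eqI[of D "- root_norm n g"] by auto
  ultimately show ?thesis
    unfolding hartley_def * by blast
qed

lemma hartley_mult_left:
  assumes "m > 0" "n > 0" "hartley (m * n) D"
  shows "hartley m D"
  using assms by (auto simp: hartley_iff_root_norm root_norm_root_norm[symmetric])

lemma hartley_1 [simp]: "n > 0 \<Longrightarrow> hartley n 1"
  by (metis hartley_iff_root_norm root_norm_1)

lemma hartley_uminus: "n > 0 \<Longrightarrow> hartley n (- D) \<longleftrightarrow> hartley n D"
  by (metis hartley_iff_root_norm minus_minus)

lemma hartley_mult:
  assumes "n > 0" "hartley n D" "hartley n E"
  shows "hartley n (D * E)"
proof -
  obtain f g where "D = root_norm n f \<or> D = - root_norm n f" "E = root_norm n g \<or> E = - root_norm n g"
    using assms by (auto simp: hartley_iff_root_norm)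
  then have "D * E = root_norm n (f * g) \<or> D * E = - root_norm n (f * g)"
    using assms by (auto simp: root_norm_mult)
  then show ?thesis
    using assms by (auto simp: hartley_iff_root_norm)
qed

text \<open>The derivative of \<open>X ^ n - x\<close> vanishes at most at 0, which is not a root.
  Hence the polynomial is a product of distinct linear factors, evaluated here at
  \<open>b\<close>.\<close>

lemma prod_nth_roots_diff:
  fixes b x :: complex
  assumes "n > 0" "x \<noteq> 0"
  shows "(\<Prod>y\<in>{y. y ^ n = x}. b - y) = b ^ n - x"
proof -
  define p where "p = monom 1 n - [:x:]"
  have pv: "poly p z = z ^ n - x" for z
    by (simp add: p_def poly_monom)
  have cp: "coeff p k = (if k = n then 1 else if k = 0 then - x else 0)" for k
    using assms by (auto simp: p_def coeff_pCons split: nat.splits)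
  have deg: "degree p = n"
  proof (rule antisym)
    show "degree p \<le> n"
      by (rule degree_le) (use assms in \<open>auto simp: cp\<close>)
    show "n \<le> degree p"
      by (rule le_degree) (simp add: cp)
  qed
  have "p \<noteq> 0"
    using deg assms by auto
  have "pderiv p = monom (of_nat n) (n - 1)"
    by (simp add: p_def pderiv_diff pderiv_monom pderiv_pCons)
  then have "rsquarefree p"
    using assms by (auto simp: rsquarefree_roots pv poly_monom power_0_left split: if_splits)
  then have "smult (lead_coeff p) (\<Prod>z|poly p z = 0. [:- z, 1:]) = p"
    by (rule complex_poly_decompose_rsquarefree)
  moreover have "lead_coeff p = 1"
    by (simp add: deg cp)
  ultimately have "poly (\<Prod>z|z ^ n = x. [:- z, 1:]) b = poly p b"
    by (simp add: pv)
  then show ?thesis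
    by (simp add: poly_prod pv)
qed

text \<open>Each root \<open>b\<close> of \<open>g\<close> contributes the product of all
  \<open>y - b\<close>, which is \<open>(- 1) ^ n * (b ^ n - x)\<close>. This explains one sign
  \<open>(- 1) ^ (n + 1)\<close> per root.\<close>

lemma root_norm_decompose:
  assumes "n > 0" and g: "map_poly of_int g = smult c (\<Prod>b\<in>#A. [:- b, 1:])"
  shows "map_poly of_int (root_norm n g) =
    smult (c ^ n * (- 1) ^ (size A * (n + 1))) (\<Prod>b\<in>#A. [:- (b ^ n), 1:] :: complex poly)" (is "?L = ?R")
proof -
  have "poly ?L x = poly ?R x" if "x \<noteq> 0" for x
  proof -
    have fin: "finite {y. y ^ n = x}" and card: "card {y. y ^ n = x} = n"
      using assms that by (auto simp: finite_nth_roots card_nth_roots)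
    have lin: "(\<Prod>y\<in>{y. y ^ n = x}. y - b) = (- 1) ^ (n + 1) * (x - b ^ n)" for b
    proof -
      have "(\<Prod>y\<in>{y. y ^ n = x}. y - b) = (\<Prod>y\<in>{y. y ^ n = x}. - 1 * (b - y))"
        by (intro prod.cong) auto
      also have "\<dots> = (- 1) ^ n * (b ^ n - x)"
        by (simp only: prod.distrib prod_constant card prod_nth_roots_diff[OF assms(1) that])
      finally show ?thesis
        by (simp add: algebra_simps)
    qed
    have *: "(\<Prod>y\<in>{y. y ^ n = x}. \<Prod>b\<in>#A. y - b) = (- 1) ^ (size A * (n + 1)) * (\<Prod>b\<in>#A. x - b ^ n)" for A
    proof (induction A)
      case (add b A)
      have "(\<Prod>y\<in>{y. y ^ n = x}. \<Prod>b\<in>#add_mset b A. y - b) =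
          (\<Prod>y\<in>{y. y ^ n = x}. y - b) * (\<Prod>y\<in>{y. y ^ n = x}. \<Prod>b\<in>#A. y - b)"
        by (simp add: prod.distrib)
      also have "\<dots> = ((- 1) ^ (n + 1) * (- 1) ^ (size A * (n + 1))) * ((x - b ^ n) * (\<Prod>b\<in>#A. x - b ^ n))"
        unfolding lin add by (simp only: mult_ac)
      also have "(- 1) ^ (n + 1) * (- 1 :: complex) ^ (size A * (n + 1)) = (- 1) ^ (size (add_mset b A) * (n + 1))"
        by (simp only: power_add[symmetric] size_add_mset mult_Suc)
      finally show ?case
        by simp
    qed simp
    have "poly ?L x = (\<Prod>y\<in>{y. y ^ n = x}. ev g y)"
      using assms(1) that by (simp add: ev_def[symmetric] ev_root_norm)
    also have "\<dots> = (\<Prod>y\<in>{y. y ^ n = x}. c * (\<Prod>b\<in>#A. y - b))"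
      by (simp add: ev_def g poly_prod_mset image_mset.compositionality o_def)
    also have "\<dots> = c ^ n * ((- 1) ^ (size A * (n + 1)) * (\<Prod>b\<in>#A. x - b ^ n))"
      by (simp only: prod.distrib prod_constant card *)
    also have "\<dots> = poly ?R x"
      by (simp only: poly_smult poly_prod_mset image_mset.compositionality o_def mult.assoc) simp
    finally show ?thesis .
  qed
  then show "?L = ?R"
    by (rule complex_poly_eqI)
qed

section \<open>Congruences modulo a constant\<close>

lemma dvd_sum_diff:
  fixes f g :: "'a \<Rightarrow> 'b :: comm_ring_1"
  assumes "\<And>i. i \<in> A \<Longrightarrow> c dvd f i - g i"
  shows "c dvd sum f A - sum g A"
  unfolding sum_subtractf[symmetric] using assms by (rule dvd_sum)

lemma dvd_mult_diff:
  fixes a b :: "'b :: comm_ring_1"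
  assumes "c dvd a - a'" "c dvd b - b'"
  shows "c dvd a * b - a' * b'"
proof -
  have "a * b - a' * b' = a * (b - b') + (a - a') * b'"
    by (simp add: algebra_simps)
  then show ?thesis
    using assms by (metis dvd_add dvd_mult dvd_mult2)
qed

lemma dvd_prod_diff:
  fixes f g :: "'a \<Rightarrow> 'b :: comm_ring_1"
  assumes "\<And>i. i \<in> A \<Longrightarrow> c dvd f i - g i"
  shows "c dvd prod f A - prod g A"
  using assms by (induction A rule: infinite_finite_induct) (auto intro: dvd_mult_diff)

lemma dvd_det_diff:
  assumes "\<And>i j. i < n \<Longrightarrow> j < n \<Longrightarrow> c dvd f i j - g i j"
  shows "c dvd Determinant.det (Matrix.mat n n (\<lambda>(i, j). f i j)) - Determinant.det (Matrix.mat n n (\<lambda>(i, j). g i j))"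
proof -
  have "p i < n" if "p permutes {0..<n}" "i < n" for p i
    using permutes_in_image[OF that(1), of i] that(2) by simp
  then show ?thesis
    unfolding Determinant.det_def using assms
    by (auto intro!: dvd_sum_diff dvd_mult_diff dvd_prod_diff)
qed

lemma mult_entry_altdef:
  assumes "degree g \<le> N"
  shows "mult_entry n g i k = (\<Sum>e\<le>N. if (e + i) mod n = k then monom (coeff g e) ((e + i) div n) else 0)"
  unfolding mult_entry_def using assms
  by (intro sum.mono_neutral_left) (auto simp: coeff_eq_0)

text \<open>The matrix entries are additive in the coefficients and the determinant is polynomial in
  the entries, so norms respect congruences modulo \<open>c\<close>.\<close>

lemma root_norm_cong:
  assumes "[:c:] dvd f - g"
  shows "[:c:] dvd root_norm n f - root_norm n g"
  unfolding root_norm_def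
proof (rule dvd_det_diff)
  fix i k
  have *: "[:c:] dvd monom (coeff f e) l - monom (coeff g e) l" for e l
    using assms by (auto simp: const_poly_dvd_iff diff_monom[symmetric] coeff_monom)
  show "[:c:] dvd mult_entry n f i k - mult_entry n g i k"
    unfolding mult_entry_altdef[of f "max (degree f) (degree g)", simplified]
      mult_entry_altdef[of g "max (degree f) (degree g)", simplified]
    by (intro dvd_sum_diff) (use * in auto)
qed

section \<open>Leading coefficient, degree and roots of a norm\<close>

lemma map_poly_of_int_decompose:
  "map_poly of_int g = smult (of_int (lead_coeff g)) (\<Prod>b\<in>#proots (map_poly of_int g). [:- b, 1:] :: complex poly)"
  using complex_poly_decompose_multiset[of "map_poly of_int g"] by simp

lemma lead_coeff_linear_prod: "lead_coeff (\<Prod>b\<in>#A. [:- f b, 1:]) = (1 :: complex)"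
  by (induction A) (simp_all add: lead_coeff_mult del: mult_pCons_left)

lemma degree_linear_prod: "degree (\<Prod>b\<in>#A. [:- f b, 1 :: complex:]) = size A"
proof (induction A)
  case (add x A)
  have "(\<Prod>b\<in>#A. [:- f b, 1 :: complex:]) \<noteq> 0"
    using lead_coeff_linear_prod[of f A] by auto
  then show ?case
    using add by (simp add: degree_mult_eq del: mult_pCons_left)
qed simp

lemma proots_linear_prod: "proots (\<Prod>b\<in>#A. [:- f b, 1 :: complex:]) = image_mset f A"
proof (induction A)
  case (add x A)
  have "(\<Prod>b\<in>#A. [:- f b, 1 :: complex:]) \<noteq> 0"
    using lead_coeff_linear_prod[of f A] by auto
  then show ?case
    using add by (simp add: proots_mult del: mult_pCons_left)
qed simp

text \<open>All three facts are read off the complex factorization of the norm; the absolute values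
  absorb its sign.\<close>

lemma
  assumes "n > 0"
  shows lead_coeff_root_norm: "\<bar>lead_coeff (root_norm n g)\<bar> = \<bar>lead_coeff g\<bar> ^ n"
    and degree_root_norm [simp]: "degree (root_norm n g) = degree g"
    and proots_root_norm: "g \<noteq> 0 \<Longrightarrow>
      proots (map_poly of_int (root_norm n g)) = image_mset (\<lambda>b :: complex. b ^ n) (proots (map_poly of_int g))"
proof -
  define A where "A = proots (map_poly of_int g :: complex poly)"
  define c :: complex where "c = of_int (lead_coeff g) ^ n * (- 1) ^ (size A * (n + 1))"
  have dec: "map_poly of_int (root_norm n g) = smult c (\<Prod>b\<in>#A. [:- (b ^ n), 1:])"
    unfolding c_def A_def by (intro root_norm_decompose assms map_poly_of_int_decompose)
  have "of_int (lead_coeff (root_norm n g)) = lead_coeff (map_poly of_int (root_norm n g) :: complex poly)"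
    by simp
  also have "\<dots> = c"
    unfolding dec lead_coeff_smult lead_coeff_linear_prod by simp
  finally have c: "of_int (lead_coeff (root_norm n g)) = c" .
  then have "of_int \<bar>lead_coeff (root_norm n g)\<bar> = norm c"
    by (metis norm_of_int of_int_abs)
  also have "norm c = of_int (\<bar>lead_coeff g\<bar> ^ n)"
    by (simp add: c_def norm_mult norm_power)
  finally show lc: "\<bar>lead_coeff (root_norm n g)\<bar> = \<bar>lead_coeff g\<bar> ^ n"
    by (simp only: of_int_eq_iff)
  show "degree (root_norm n g) = degree g"
  proof (cases "g = 0")
    case True
    then have "lead_coeff (root_norm n g) = 0"
      using lc assms by (simp add: power_0_left)
    with True show ?thesis
      by simp
  next
    case False
    then have "c \<noteq> 0"
      by (simp add: c_def)
    have "degree (root_norm n g) = degree (map_poly of_int (root_norm n g) :: complex poly)"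
      by simp
    also have "\<dots> = size A"
      unfolding dec using \<open>c \<noteq> 0\<close> by (simp add: degree_linear_prod)
    also have "\<dots> = degree g"
      by (simp add: A_def size_proots_complex)
    finally show ?thesis .
  qed
  assume "g \<noteq> 0"
  then have "c \<noteq> 0"
    by (simp add: c_def)
  then show "proots (map_poly of_int (root_norm n g)) = image_mset (\<lambda>b :: complex. b ^ n) (proots (map_poly of_int g))"
    unfolding dec by (simp add: proots_linear_prod A_def)
qed

lemma root_norm_eq_0_iff [simp]: "n > 0 \<Longrightarrow> root_norm n g = 0 \<longleftrightarrow> g = 0"
  using lead_coeff_root_norm[of n g] by (auto simp del: degree_root_norm simp: power_0_left)

text \<open>Modulo a prime \<open>p\<close>, a primitive \<open>g\<close> may be replaced by a polynomial whose leading coefficient is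
  prime to \<open>p\<close>.\<close>

lemma content_root_norm:
  assumes "n > 0" "content g = 1"
  shows "content (root_norm n g) = 1"
proof (rule ccontr)
  assume "content (root_norm n g) \<noteq> 1"
  moreover have "g \<noteq> 0"
    using assms by auto
  ultimately have "content (root_norm n g) \<noteq> 0" "\<not> is_unit (content (root_norm n g))"
    using assms(1) by (simp_all only: content_eq_zero_iff root_norm_eq_0_iff is_unit_content_iff not_False_eq_True)
  then obtain p where p: "p dvd content (root_norm n g)" "prime p"
    using prime_divisor_exists by blast
  define S where "S = {i. \<not> p dvd coeff g i}"
  have "S \<noteq> {}"
  proof
    assume "S = {}"
    then have "[:p:] dvd g"
      by (auto simp: S_def const_poly_dvd_iff)
    then have "p dvd content g"
      by (simp add: const_poly_dvd_iff_dvd_content)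
    with assms p show False
      by (simp add: not_prime_unit)
  qed
  have "S \<subseteq> {..degree g}"
    by (auto simp: S_def intro: ccontr) (metis coeff_eq_0 dvd_0_right not_le)
  then have fin: "finite S"
    by (rule finite_subset) simp
  define s where "s = Max S"
  have s: "\<not> p dvd coeff g s" "\<And>i. i > s \<Longrightarrow> p dvd coeff g i"
    using Max_in[OF fin \<open>S \<noteq> {}\<close>] Max_ge[OF fin] by (auto simp: s_def S_def not_le[symmetric])
  define h where "h = (\<Sum>i\<le>s. monom (coeff g i) i)"
  have ch: "coeff h i = (if i \<le> s then coeff g i else 0)" for i
    by (auto simp: h_def coeff_sum)
  have "degree h = s"
    using s by (intro antisym degree_le le_degree) (auto simp: ch)
  have "[:p:] dvd g - h"
    using s by (auto simp: const_poly_dvd_iff ch)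
  then have "[:p:] dvd root_norm n g - root_norm n h"
    by (rule root_norm_cong)
  moreover have "[:p:] dvd root_norm n g"
    using p by (simp add: const_poly_dvd_iff_dvd_content)
  ultimately have "[:p:] dvd root_norm n g - (root_norm n g - root_norm n h)"
    by (rule dvd_diff[rotated])
  then have "[:p:] dvd root_norm n h"
    by simp
  then have "p dvd \<bar>lead_coeff (root_norm n h)\<bar>"
    by (simp add: const_poly_dvd_iff)
  then have "p dvd \<bar>coeff g s\<bar> ^ n"
    unfolding lead_coeff_root_norm[OF assms(1)] by (simp add: \<open>degree h = s\<close> ch)
  then have "p dvd \<bar>coeff g s\<bar>"
    by (rule prime_dvd_power[OF p(2)])
  then have "p dvd coeff g s"
    by (simp only: dvd_abs_iff)
  with s show False by simp
qed

section \<open>Conjugate algebraic numbers\<close>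

lemma ev_is_unit: "is_unit f \<Longrightarrow> ev f a \<noteq> 0"
  by (metis dvdE ev_1 ev_mult mult_zero_left zero_neq_one)

lemma degree_gt_0_of_ev_eq_0:
  assumes "f \<noteq> 0" "ev f a = 0"
  shows "degree f > 0"
  using assms by (metis degree_eq_zeroE ev_const gr0I of_int_eq_0_iff pCons_eq_0_iff)

lemma obtain_prime_elem_root:
  assumes "f \<noteq> 0" "ev f a = 0"
  obtains P where "prime_elem P" "ev P a = 0"
proof -
  have "f \<noteq> 0 \<Longrightarrow> ev f a = 0 \<Longrightarrow> \<exists>P. prime_elem P \<and> ev P a = 0" for f
    by (induction f rule: prime_divisors_induct) (auto simp: ev_is_unit prime_imp_prime_elem)
  with assms that show ?thesis
    by blast
qed

lemma algebraic_iff_ev: "algebraic a \<longleftrightarrow> (\<exists>f. f \<noteq> 0 \<and> ev f a = 0)"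
proof
  assume "algebraic a"
  then obtain p where p: "\<And>i. coeff p i \<in> \<int>" "p \<noteq> 0" "poly p a = 0"
    using algebraicE by blast
  obtain f where "p = map_poly of_int f"
    using p(1) by (rule intpolyE)
  with p show "\<exists>f. f \<noteq> 0 \<and> ev f a = 0"
    by (auto simp: ev_def)
next
  assume "\<exists>f. f \<noteq> 0 \<and> ev f a = 0"
  then obtain f where "f \<noteq> 0" "poly (map_poly of_int f) a = 0"
    by (auto simp: ev_def)
  then show "algebraic a"
    by (intro algebraicI[of "map_poly of_int f"]) auto
qed

lemma algebraic_prime_elem:
  assumes "algebraic a"
  obtains P where "prime_elem P" "ev P a = 0"
  using assms obtain_prime_elem_root unfolding algebraic_iff_ev by blast

text \<open>By pseudo-division, a polynomial \<open>f\<close> of least degree vanishing at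
  \<open>a\<close> divides a nonzero integer multiple of every other one. Primality of
  \<open>P\<close> then gives \<open>P dvd f\<close>, and \<open>P\<close>, being nonconstant,
  cannot divide the integer factor of \<open>h\<close>.\<close>

lemma prime_elem_dvd_of_root:
  assumes "prime_elem P" "ev P a = 0" "ev h a = 0"
  shows "P dvd h"
proof -
  have P0: "P \<noteq> 0"
    using assms(1) by auto
  have "\<exists>f. (f \<noteq> 0 \<and> ev f a = 0) \<and> (\<forall>g. g \<noteq> 0 \<and> ev g a = 0 \<longrightarrow> degree f \<le> degree g)"
    by (rule ex_has_least_nat[of _ P]) (use P0 assms(2) in simp)
  then obtain f where f: "f \<noteq> 0" "ev f a = 0" and min: "\<And>g. g \<noteq> 0 \<Longrightarrow> ev g a = 0 \<Longrightarrow> degree f \<le> degree g"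
    by blast
  have div: "\<exists>c q. c \<noteq> 0 \<and> smult c g = f * q" if "ev g a = 0" for g
  proof -
    obtain c q where cq: "c \<noteq> 0" "smult c g = f * q + pseudo_mod g f"
      using pseudo_mod(1)[OF f(1), of g] by blast
    have "ev (pseudo_mod g f) a = 0"
      using arg_cong[OF cq(2), of "\<lambda>f. ev f a"] that f by simp
    then have "pseudo_mod g f = 0"
      using pseudo_mod(2)[OF f(1), of g] min[of "pseudo_mod g f"] by (auto simp: not_le[symmetric])
    with cq show ?thesis
      by auto
  qed
  obtain c q where cq: "c \<noteq> 0" "smult c P = f * q"
    using div assms by blast
  have "P dvd f * q"
    by (simp add: cq(2)[symmetric] dvd_smult)
  \<comment> \<open>Otherwise cancelling \<open>P\<close> makes \<open>f\<close> a divisor of the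
    nonzero constant \<open>c\<close>, although \<open>f\<close> vanishes at
    \<open>a\<close>.\<close>
  moreover have "\<not> P dvd q"
  proof
    assume "P dvd q"
    then obtain r where "q = P * r"
      by auto
    with cq have "P * [:c:] = P * (f * r)"
      by (simp add: mult_ac)
    with P0 have "[:c:] = f * r"
      by (simp only: mult_cancel_left) simp
    then have "of_int c = ev f a * ev r a"
      by (metis ev_const ev_mult)
    with f cq show False
      by simp
  qed
  ultimately have "P dvd f"
    using assms(1) by (simp add: prime_elem_dvd_mult_iff)
  obtain d p where dp: "d \<noteq> 0" "smult d h = f * p"
    using div assms by blast
  then have "P dvd [:d:] * h"
    using \<open>P dvd f\<close> by simp
  moreover have "\<not> P dvd [:d:]"
    using degree_gt_0_of_ev_eq_0[OF P0 assms(2)] dp(1) by (auto dest!: dvd_imp_degree_le)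
  ultimately show ?thesis
    using assms(1) by (simp only: prime_elem_dvd_mult_iff) simp
qed

text \<open>A double root would be a root of the derivative, so \<open>P\<close> would divide a
  nonzero polynomial of smaller degree.\<close>

lemma rsquarefree_of_int_prime_elem:
  assumes "prime_elem P" "ev P a = 0"
  shows "rsquarefree (map_poly of_int P :: complex poly)"
  unfolding rsquarefree_roots
proof (intro allI notI)
  fix b :: complex
  assume b: "poly (map_poly of_int P) b = 0 \<and> poly (pderiv (map_poly of_int P)) b = 0"
  then have "ev P b = 0" "ev (pderiv P) b = 0"
    by (simp_all add: ev_def of_int_hom.map_poly_pderiv)
  then have "P dvd pderiv P"
    using assms(1) prime_elem_dvd_of_root by blast
  moreover have "degree P > 0"
    using assms degree_gt_0_of_ev_eq_0 by auto
  ultimately show False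
    using dvd_imp_degree_le[of P "pderiv P"] by (auto simp: degree_pderiv pderiv_eq_0_iff)
qed

text \<open>Galois conjugates without a minimal polynomial. For algebraic \<open>a\<close> they are
  the roots of any prime element vanishing at \<open>a\<close>, and their number is the degree of
  Q(a) over the rationals.\<close>

definition conjugates :: "complex \<Rightarrow> complex set" where
  "conjugates a = {z. \<forall>f. ev f a = 0 \<longrightarrow> ev f z = 0}"

lemma conjugates_refl [simp, intro]: "a \<in> conjugates a"
  by (simp add: conjugates_def)

lemma conjugatesD: "z \<in> conjugates a \<Longrightarrow> ev f a = 0 \<Longrightarrow> ev f z = 0"
  by (simp add: conjugates_def)

lemma conjugates_eq_roots:
  assumes "prime_elem P" "ev P a = 0"
  shows "conjugates a = {z. ev P z = 0}"
  using prime_elem_dvd_of_root[OF assms] assms(2) unfolding conjugates_def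
  by (force elim!: dvdE)

lemma
  assumes "prime_elem P" "ev P a = 0"
  shows proots_prime_elem: "proots (map_poly of_int P) = mset_set (conjugates a)"
    and card_conjugates: "card (conjugates a) = degree P"
    and finite_conjugates: "finite (conjugates a)"
proof -
  have P0: "P \<noteq> 0"
    using assms(1) by auto
  show fin: "finite (conjugates a)"
    using P0 by (simp add: conjugates_eq_roots[OF assms] finite_ev_roots)
  show eq: "proots (map_poly of_int P) = mset_set (conjugates a)"
  proof (rule multiset_eqI)
    fix z
    show "count (proots (map_poly of_int P)) z = count (mset_set (conjugates a)) z"
      using rsquarefree_root_order[OF rsquarefree_of_int_prime_elem[OF assms], of z] P0 fin
      by (auto simp: conjugates_eq_roots[OF assms] count_mset_set' ev_def order_root)
  qed
  have "size (proots (map_poly of_int P :: complex poly)) = degree P"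
    by (simp add: size_proots_complex)
  then show "card (conjugates a) = degree P"
    by (simp add: eq)
qed

lemma conjugates_eq:
  assumes "algebraic a" "b \<in> conjugates a"
  shows "conjugates b = conjugates a"
proof -
  obtain P where P: "prime_elem P" "ev P a = 0"
    using assms(1) by (rule algebraic_prime_elem)
  then have "ev P b = 0"
    using assms(2) by (auto dest: conjugatesD)
  with P show ?thesis
    by (simp add: conjugates_eq_roots)
qed

lemma content_prime_elem:
  fixes P :: "int poly"
  assumes "prime_elem P" "degree P > 0"
  shows "content P = 1"
proof -
  have "Factorial_Ring.irreducible P"
    using assms(1) by (rule prime_elem_imp_irreducible)
  moreover have "P = [:content P:] * primitive_part P"
    by simp
  ultimately have "is_unit [:content P:] \<or> is_unit (primitive_part P)"
    by (rule Factorial_Ring.irreducibleD)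
  moreover have "\<not> is_unit (primitive_part P)"
    using assms(2) by (metis degree_primitive_part is_unit_iff_degree is_unit_poly_iff degree_pCons_0 less_irrefl)
  ultimately have "is_unit [:content P:]"
    by blast
  then show ?thesis
    by (simp only: is_unit_const_poly_iff is_unit_content_iff)
qed

lemma ev_root_norm_eq_0D:
  assumes "n > 0" "g \<noteq> 0" "ev (root_norm n g) z = 0"
  obtains r where "z = r ^ n" "ev g r = 0"
proof -
  have "z \<in># proots (map_poly of_int (root_norm n g))"
    using assms by (simp add: ev_def)
  then show ?thesis
    using that assms(2) by (auto simp: proots_root_norm[OF assms(1)] ev_def)
qed

lemma prime_elem_has_root:
  assumes "prime_elem P" "content P = 1"
  obtains z where "ev P z = 0"
proof -
  have "degree P > 0"
  proof (rule ccontr)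
    assume "\<not> degree P > 0"
    then obtain c where "P = [:c:]"
      by (auto elim: degree_eq_zeroE)
    with assms show False
      by (auto simp: is_unit_const_poly_iff prime_elem_def)
  qed
  then have "\<not> constant (poly (map_poly of_int P :: complex poly))"
    by (simp add: constant_degree)
  then show ?thesis
    using that fundamental_theorem_of_algebra unfolding ev_def by blast
qed

text \<open>A prime factor \<open>p\<close> of the cofactor of the \<open>R\<close>-part has a root
  \<open>r ^ n\<close> with \<open>r\<close> a root of \<open>Q\<close>. Hence \<open>Q\<close>
  divides \<open>p\<close> composed with \<open>X ^ n\<close>, so \<open>p\<close> vanishes at
  \<open>b ^ n\<close> and \<open>R\<close> divides \<open>p\<close>, a contradiction.\<close>

lemma root_norm_prime_elem:
  assumes Q: "prime_elem Q" "ev Q b = 0" and R: "prime_elem R" "ev R (b ^ n) = 0" and n: "n > 0"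
  defines "s \<equiv> card {r \<in> conjugates b. r ^ n = b ^ n}"
  obtains u where "is_unit u" "root_norm n Q = u * R ^ s"
proof -
  have nz: "Q \<noteq> 0" "R \<noteq> 0"
    using Q R by auto
  define k where "k = multiplicity R (root_norm n Q)"
  define u where "u = root_norm n Q div R ^ k"
  have u: "root_norm n Q = R ^ k * u"
    unfolding u_def k_def by (simp add: multiplicity_dvd)
  have Ru: "\<not> R dvd u"
    unfolding u_def k_def using nz n R(1)
    by (intro multiplicity_decompose) (auto dest: prime_elem_not_unit)
  have u0: "u \<noteq> 0"
    using Ru by auto
  have unit: "is_unit u"
  proof (rule ccontr)
    assume "\<not> is_unit u"
    then obtain p where p: "p dvd u" "prime p"
      using u0 prime_divisor_exists by blast
    \<comment> \<open>Content 1 excludes constant primes \<open>p\<close>, which would have no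
      root.\<close>
    have "content p dvd content (root_norm n Q)"
      using p u by auto
    then have "content p = 1"
      using content_root_norm[OF n content_prime_elem[OF Q(1) degree_gt_0_of_ev_eq_0[OF nz(1) Q(2)]]]
      by (simp flip: is_unit_content_iff)
    then obtain z where z: "ev p z = 0"
      using p(2) by (metis prime_elem_has_root prime_imp_prime_elem)
    with p u have "ev (root_norm n Q) z = 0"
      by auto
    then obtain r where r: "z = r ^ n" "ev Q r = 0"
      using ev_root_norm_eq_0D[OF n nz(1)] by blast
    have "Q dvd pcompose p (monom 1 n)"
      using r z by (intro prime_elem_dvd_of_root[OF Q(1) r(2)]) simp
    then have "ev p (b ^ n) = 0"
      using Q(2) by (auto elim!: dvdE dest!: arg_cong[of _ _ "\<lambda>f. ev f b"])
    then have "R dvd p"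
      using prime_elem_dvd_of_root[OF R] by blast
    with p(1) Ru show False
      using dvd_trans by blast
  qed
  have "proots (map_poly of_int (root_norm n Q)) = repeat_mset k (proots (map_poly of_int R :: complex poly))"
    using nz u0 unit unfolding u
    by (auto simp: hom_distribs proots_mult proots_power is_unit_poly_iff)
  \<comment> \<open>The exponent is found by counting \<open>b ^ n\<close> among the roots on both
    sides; those of \<open>Q\<close> and of \<open>R\<close> are simple.\<close>
  then have "count (image_mset (\<lambda>b. b ^ n) (mset_set (conjugates b))) (b ^ n) =
      k * count (mset_set (conjugates (b ^ n))) (b ^ n)"
    using nz by (simp add: proots_root_norm[OF n] proots_prime_elem[OF Q] proots_prime_elem[OF R])
  then have "s = k"
    using finite_conjugates[OF Q] finite_conjugates[OF R]
    by (simp add: s_def count_image_mset' eq_commute[of "b ^ n"])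
  then show ?thesis
    using that unit u by (simp add: mult.commute)
qed

section \<open>Degrees of powers and of roots\<close>

lemma algebraic_evE:
  assumes "algebraic a"
  obtains f where "f \<noteq> 0" "ev f a = 0"
  using assms by (auto simp: algebraic_iff_ev)

lemma algebraic_power:
  fixes b :: complex
  assumes "algebraic b" "n > 0"
  shows "algebraic (b ^ n)"
proof (cases "b = 0")
  case False
  obtain f where f: "f \<noteq> 0" "ev f b = 0"
    using assms(1) by (rule algebraic_evE)
  have "ev (root_norm n f) (b ^ n) = (\<Prod>y\<in>{y. y ^ n = b ^ n}. ev f y)"
    using assms(2) False by (intro ev_root_norm) auto
  also have "\<dots> = 0"
    using f(2) assms(2) by (intro prod_zero) (auto simp: finite_nth_roots)
  finally show ?thesis
    unfolding algebraic_iff_ev using f(1) assms(2) by (intro exI[of _ "root_norm n f"]) simp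
qed (use assms in \<open>simp add: power_0_left\<close>)

lemma algebraic_root:
  fixes b :: complex
  assumes "algebraic (b ^ n)" "n > 0"
  shows "algebraic b"
proof -
  obtain f where f: "f \<noteq> 0" "ev f (b ^ n) = 0"
    using assms(1) by (rule algebraic_evE)
  moreover have "pcompose f (monom 1 n) \<noteq> 0"
    using f(1) assms(2) by (subst pcompose_eq_0_iff) (auto simp: degree_monom_eq)
  ultimately show ?thesis
    unfolding algebraic_iff_ev by (intro exI[of _ "pcompose f (monom 1 n)"]) simp
qed

lemma finite_conjugates_algebraic: "algebraic b \<Longrightarrow> finite (conjugates b)"
  by (metis algebraic_prime_elem finite_conjugates)

lemma card_conjugates_pos: "algebraic b \<Longrightarrow> card (conjugates b) > 0"
  using finite_conjugates_algebraic conjugates_refl by (metis card_gt_0_iff empty_iff)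

lemma conjugates_power:
  assumes "r \<in> conjugates b"
  shows "r ^ n \<in> conjugates (b ^ n)"
  using conjugatesD[OF assms, of "pcompose f (monom 1 n)" for f] by (simp add: conjugates_def)

text \<open>The tower law, with the fibre size as the degree of Q(b) over Q(b ^ n). Norms preserve
  degrees, so it suffices to compare degrees in \<open>root_norm_prime_elem\<close>.\<close>

lemma card_conjugates_power:
  assumes "algebraic b" "n > 0"
  shows "card (conjugates b) = card {r \<in> conjugates b. r ^ n = b ^ n} * card (conjugates (b ^ n))"
proof -
  obtain Q where Q: "prime_elem Q" "ev Q b = 0"
    using assms(1) by (rule algebraic_prime_elem)
  obtain R where R: "prime_elem R" "ev R (b ^ n) = 0"
    using algebraic_power[OF assms] by (rule algebraic_prime_elem)
  obtain u where u: "is_unit u" "root_norm n Q = u * R ^ card {r \<in> conjugates b. r ^ n = b ^ n}"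
    using root_norm_prime_elem[OF Q R assms(2)] by blast
  have "u \<noteq> 0" "R \<noteq> 0"
    using u(1) R(1) by auto
  moreover have "degree u = 0"
    using u(1) by (auto simp: is_unit_poly_iff)
  ultimately have "degree Q = card {r \<in> conjugates b. r ^ n = b ^ n} * degree R"
    using arg_cong[OF u(2), of degree] assms(2) by (simp add: degree_mult_eq degree_power_eq)
  then show ?thesis
    by (simp add: card_conjugates[OF Q] card_conjugates[OF R])
qed

lemma card_conjugates_power_dvd:
  "algebraic b \<Longrightarrow> n > 0 \<Longrightarrow> card (conjugates (b ^ n)) dvd card (conjugates b)"
  by (subst card_conjugates_power[of b n]) auto

section \<open>Relative norms\<close>

text \<open>Division by 0 is harmless in \<open>divide_mem\<close>, its value being 0.\<close>

locale complex_subfield =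
  fixes K :: "complex set"
  assumes one_mem: "1 \<in> K"
    and diff_mem: "x \<in> K \<Longrightarrow> y \<in> K \<Longrightarrow> x - y \<in> K"
    and divide_mem: "x \<in> K \<Longrightarrow> y \<in> K \<Longrightarrow> x / y \<in> K"
begin

lemma zero_mem: "0 \<in> K"
  using diff_mem[OF one_mem one_mem] by simp

lemma uminus_mem: "x \<in> K \<Longrightarrow> - x \<in> K"
  using diff_mem[OF zero_mem] by simp

lemma add_mem: "x \<in> K \<Longrightarrow> y \<in> K \<Longrightarrow> x + y \<in> K"
  using diff_mem[OF _ uminus_mem, of x y] by simp

lemma mult_mem: "x \<in> K \<Longrightarrow> y \<in> K \<Longrightarrow> x * y \<in> K"
  using divide_mem[OF _ divide_mem[OF one_mem], of x y] by simp

lemma power_mem: "x \<in> K \<Longrightarrow> x ^ k \<in> K"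
  by (induction k) (auto intro: one_mem mult_mem)

lemma sum_mem: "(\<And>i. i \<in> A \<Longrightarrow> f i \<in> K) \<Longrightarrow> sum f A \<in> K"
  by (induction A rule: infinite_finite_induct) (auto intro: zero_mem add_mem)

lemma of_nat_mem: "of_nat k \<in> K"
  by (induction k) (auto intro: zero_mem add_mem one_mem)

lemma of_int_mem: "of_int k \<in> K"
  by (cases k) (auto intro: of_nat_mem uminus_mem diff_mem one_mem)

lemmas mem = one_mem zero_mem uminus_mem add_mem diff_mem mult_mem divide_mem power_mem of_int_mem

definition polys :: "complex poly set" where
  "polys = {p. \<forall>i. coeff p i \<in> K}"

lemma polys_diff: "p \<in> polys \<Longrightarrow> q \<in> polys \<Longrightarrow> p - q \<in> polys"
  by (simp add: polys_def diff_mem)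

lemma polys_add: "p \<in> polys \<Longrightarrow> q \<in> polys \<Longrightarrow> p + q \<in> polys"
  by (simp add: polys_def add_mem)

lemma polys_mult: "p \<in> polys \<Longrightarrow> q \<in> polys \<Longrightarrow> p * q \<in> polys"
  by (auto simp: polys_def coeff_mult intro!: sum_mem mult_mem)

lemma polys_smult: "c \<in> K \<Longrightarrow> p \<in> polys \<Longrightarrow> smult c p \<in> polys"
  by (simp add: polys_def mult_mem)

lemma polys_monom: "c \<in> K \<Longrightarrow> monom c n \<in> polys"
  by (simp add: polys_def zero_mem)

lemma polys_of_int: "map_poly of_int p \<in> polys"
  by (simp add: polys_def of_int_mem)

text \<open>Long division, by induction on a bound for the excess of the degree of \<open>p\<close>
  over that of \<open>q\<close>. Each step divides leading coefficients only, so it stays in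
  \<open>K\<close>.\<close>

lemma polys_division:
  assumes "p \<in> polys" "q \<in> polys" "q \<noteq> 0"
  obtains s r where "s \<in> polys" "r \<in> polys" "p = q * s + r" "r = 0 \<or> degree r < degree q"
proof -
  have "\<exists>s r. s \<in> polys \<and> r \<in> polys \<and> p = q * s + r \<and> (r = 0 \<or> degree r < degree q)"
    if "p \<in> polys" "degree p < degree q + k" for p k
    using that
  proof (induction k arbitrary: p)
    case 0
    then show ?case
      by (intro exI[of _ 0] exI[of _ p]) (auto simp: polys_def zero_mem)
  next
    case (Suc k)
    show ?case
    proof (cases "degree p < degree q + k")
      case True
      with Suc show ?thesis by blast
    next
      case False
      with Suc.prems have deg: "degree p = degree q + k"
        by simp
      define t where "t = monom (lead_coeff p / lead_coeff q) k"
      have t: "t \<in> polys"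
        unfolding t_def using Suc.prems assms by (intro polys_monom divide_mem) (auto simp: polys_def)
      define p' where "p' = p - q * t"
      have p': "p' \<in> polys"
        using t Suc.prems assms by (auto simp: p'_def intro!: polys_diff polys_mult)
      have "degree (q * t) \<le> degree q + k"
        by (rule order.trans[OF degree_mult_le]) (simp add: t_def degree_monom_le)
      then have le: "degree p' \<le> degree q + k"
        unfolding p'_def using deg by (intro degree_diff_le) auto
      have "coeff (q * t) (degree q + k) = lead_coeff p"
        using assms(3) by (simp add: t_def mult.commute[of q] coeff_monom_mult)
      then have "coeff p' (degree q + k) = 0"
        by (simp add: p'_def deg)
      then have "p' = 0 \<or> degree p' < degree q + k"
        using le by (metis le_neq_implies_less leading_coeff_0_iff)
      then obtain s r where "s \<in> polys" "r \<in> polys" "p' = q * s + r" "r = 0 \<or> degree r < degree q"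
      proof
        assume "p' = 0"
        then show ?thesis
          by (intro that[of 0 0]) (auto simp: polys_def zero_mem)
      next
        assume "degree p' < degree q + k"
        with Suc.IH[OF p'] that show ?thesis
          by blast
      qed
      moreover from this have "p = q * (s + t) + r"
        by (simp add: p'_def algebra_simps)
      ultimately show ?thesis
        using t polys_add by blast
    qed
  qed
  from this[of p "Suc (degree p)"] assms that show ?thesis
    by auto
qed

text \<open>Euclid's algorithm over \<open>K\<close>: the pairs \<open>p\<close>, \<open>q\<close>
  and \<open>q\<close>, \<open>r\<close> have the same common divisors and the same common
  zeros.\<close>

lemma polys_common_divisor:
  assumes "p \<in> polys" "q \<in> polys" "p \<noteq> 0"
  obtains h where "h \<in> polys" "h \<noteq> 0" "h dvd p" "h dvd q"
    "\<And>x. poly p x = 0 \<Longrightarrow> poly q x = 0 \<Longrightarrow> poly h x = 0"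
proof -
  have "\<exists>h. h \<in> polys \<and> h \<noteq> 0 \<and> h dvd p \<and> h dvd q \<and> (\<forall>x. poly p x = 0 \<longrightarrow> poly q x = 0 \<longrightarrow> poly h x = 0)"
    if "p \<in> polys" "q \<in> polys" "p \<noteq> 0 \<or> q \<noteq> 0" for p q
    using that
  \<comment> \<open>The zero polynomial must rank below the nonzero constants, with which it shares
    degree 0.\<close>
  proof (induction "if q = 0 then 0 else Suc (degree q)" arbitrary: p q rule: less_induct)
    case less
    show ?case
    proof (cases "q = 0")
      case True
      with less.prems show ?thesis
        by (intro exI[of _ p]) auto
    next
      case False
      obtain s r where sr: "s \<in> polys" "r \<in> polys" "p = q * s + r" "r = 0 \<or> degree r < degree q"
        using polys_division[OF less.prems(1,2) False] .
      then have "\<exists>h. h \<in> polys \<and> h \<noteq> 0 \<and> h dvd q \<and> h dvd r \<and>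
          (\<forall>x. poly q x = 0 \<longrightarrow> poly r x = 0 \<longrightarrow> poly h x = 0)"
        using less.hyps[of r q] less.prems(2) False by (cases "r = 0") auto
      then obtain h where "h \<in> polys" "h \<noteq> 0" "h dvd q" "h dvd r"
          "\<forall>x. poly q x = 0 \<longrightarrow> poly r x = 0 \<longrightarrow> poly h x = 0"
        by (elim exE conjE)
      then show ?thesis
        using sr(3) by (intro exI[of _ h]) auto
    qed
  qed
  then show ?thesis
    using assms that by blast
qed

text \<open>Symmetry of the resultant up to sign.\<close>

lemma prod_mset_diff_swap:
  fixes A B :: "complex multiset"
  shows "(\<Prod>a\<in>#A. \<Prod>b\<in>#B. a - b) = (- 1) ^ (size A * size B) * (\<Prod>b\<in>#B. \<Prod>a\<in>#A. b - a)"
proof (induction A)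
  case (add a A)
  have "(\<Prod>b\<in>#B. a - b) = (- 1) ^ size B * (\<Prod>b\<in>#B. b - a)" for B
    by (induction B) (auto simp: algebra_simps)
  with add show ?case
    by (simp add: prod_mset.distrib power_add)
qed simp

text \<open>Euclid's algorithm: \<open>f\<close> may be reduced modulo the polynomial with roots \<open>A\<close>, and then the two
  polynomials exchange their roles, as for a resultant.\<close>

lemma prod_roots_mem:
  assumes "(\<Prod>a\<in>#A. [:- a, 1:]) \<in> polys" "f \<in> polys"
  shows "(\<Prod>a\<in>#A. poly f a) \<in> K"
  using assms
proof (induction "size A" arbitrary: A f rule: less_induct)
  case less
  let ?M = "\<lambda>A. \<Prod>a\<in>#A. [:- a, 1 :: complex:]"
  have M: "poly (?M A) z = (\<Prod>a\<in>#A. z - a)" for A z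
    by (simp add: poly_prod_mset image_mset.compositionality o_def)
  have "?M A \<noteq> 0"
    using lead_coeff_linear_prod[of "\<lambda>a. a" A] by auto
  then obtain s r where sr: "s \<in> polys" "r \<in> polys" "f = ?M A * s + r" "r = 0 \<or> degree r < degree (?M A)"
    using polys_division[OF less.prems(2,1)] by blast
  have "poly (?M A) a = 0" if "a \<in># A" for a
    unfolding M using that by (auto simp: prod_mset_zero_iff)
  then have fr: "(\<Prod>a\<in>#A. poly f a) = (\<Prod>a\<in>#A. poly r a)"
    using sr(3) by (intro arg_cong[of _ _ prod_mset] image_mset_cong) simp
  show ?case
  proof (cases "r = 0 \<or> A = {#}")
    case True
    then show ?thesis
      unfolding fr by (cases A) (auto simp: mem)
  next
    case False
    define c where "c = lead_coeff r"
    define B where "B = proots r"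
    have c: "c \<in> K" "c \<noteq> 0"
      using sr False by (auto simp: c_def polys_def)
    have r: "r = smult c (?M B)"
      using complex_poly_decompose_multiset[of r] by (simp add: c_def B_def)
    then have MB: "?M B = smult (1 / c) r"
      using c by simp
    have "size B < size A"
      using sr(4) False by (auto simp: B_def size_proots_complex degree_linear_prod)
    moreover have "?M B \<in> polys"
      unfolding MB using c sr by (intro polys_smult mem)
    ultimately have IH: "(\<Prod>b\<in>#B. poly (?M A) b) \<in> K"
      using less by blast
    have "(\<Prod>a\<in>#A. c * x a) = c ^ size A * (\<Prod>a\<in>#A. x a)" for x A
      by (induction A) (auto simp: mult_ac)
    then have "(\<Prod>a\<in>#A. poly r a) = c ^ size A * (\<Prod>a\<in>#A. \<Prod>b\<in>#B. a - b)"
      unfolding r by (simp only: poly_smult M)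
    also have "\<dots> = c ^ size A * ((- 1) ^ (size A * size B) * (\<Prod>b\<in>#B. poly (?M A) b))"
      unfolding M by (subst prod_mset_diff_swap) (rule refl)
    also have "\<dots> \<in> K"
      using IH c by (intro mem)
    finally show ?thesis
      unfolding fr .
  qed
qed

end

section \<open>The field generated by a complex number\<close>

definition rat_gen :: "complex \<Rightarrow> complex set" where
  "rat_gen a = {ev f a / ev g a | f g. ev g a \<noteq> 0}"

lemma rat_genI: "ev g a \<noteq> 0 \<Longrightarrow> x = ev f a / ev g a \<Longrightarrow> x \<in> rat_gen a"
  by (auto simp: rat_gen_def)

lemma rat_genE:
  assumes "x \<in> rat_gen a"
  obtains f g where "ev g a \<noteq> 0" "x = ev f a / ev g a"
  using assms by (auto simp: rat_gen_def)

interpretation rat_gen: complex_subfield "rat_gen a" for a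
proof
  show "1 \<in> rat_gen a"
    by (rule rat_genI[of 1 _ _ 1]) auto
next
  fix x y assume "x \<in> rat_gen a" "y \<in> rat_gen a"
  then obtain f g h k where fg: "ev g a \<noteq> 0" "x = ev f a / ev g a" and hk: "ev k a \<noteq> 0" "y = ev h a / ev k a"
    by (auto elim!: rat_genE)
  show "x - y \<in> rat_gen a"
    using fg(1) hk(1) unfolding fg(2) hk(2)
    by (intro rat_genI[of "g * k" _ _ "f * k - h * g"]) (auto simp: field_simps)
  show "x / y \<in> rat_gen a"
  proof (cases "ev h a = 0")
    case True
    with hk show ?thesis
      by (intro rat_genI[of 1 _ _ 0]) auto
  next
    case False
    then show ?thesis
      unfolding fg(2) hk(2) using fg(1) by (intro rat_genI[of "g * h" _ _ "f * k"]) simp_all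
  qed
qed

lemma self_mem_rat_gen: "a \<in> rat_gen a"
  by (rule rat_genI[of 1 _ _ "monom 1 1"]) auto

text \<open>The fibre consists of the common roots of the irreducible polynomial of \<open>b\<close>
  and \<open>X ^ n - b ^ n\<close>. Both have coefficients in Q(b ^ n), hence so does the monic
  polynomial whose roots are the fibre, and \<open>prod_roots_mem\<close> applies.\<close>

lemma prod_fibre_mem:
  assumes b: "algebraic b"
  shows "(\<Prod>r\<in>{r \<in> conjugates b. r ^ n = b ^ n}. ev f r) \<in> rat_gen (b ^ n)"
proof -
  define S where "S = {r \<in> conjugates b. r ^ n = b ^ n}"
  have fin: "finite S"
    using finite_conjugates_algebraic[OF b] by (simp add: S_def)
  obtain P where P: "prime_elem P" "ev P b = 0"
    using b by (rule algebraic_prime_elem)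
  define p :: "complex poly" where "p = map_poly of_int P"
  define q where "q = monom 1 n - monom (b ^ n) 0"
  have "p \<noteq> 0"
    using P(1) by (auto simp: p_def)
  have p: "p \<in> rat_gen.polys (b ^ n)"
    unfolding p_def by (rule rat_gen.polys_of_int)
  have q: "q \<in> rat_gen.polys (b ^ n)"
    unfolding q_def by (intro rat_gen.polys_diff rat_gen.polys_monom rat_gen.one_mem self_mem_rat_gen)
  obtain h where h: "h \<in> rat_gen.polys (b ^ n)" "h \<noteq> 0" "h dvd p" "h dvd q"
      and common: "\<And>x. poly p x = 0 \<Longrightarrow> poly q x = 0 \<Longrightarrow> poly h x = 0"
    using rat_gen.polys_common_divisor[OF p q \<open>p \<noteq> 0\<close>] by blast
  have pS: "poly p x = 0 \<and> poly q x = 0 \<longleftrightarrow> x \<in> S" for x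
    by (simp add: S_def conjugates_eq_roots[OF P] p_def ev_def q_def poly_monom)
  have hS: "{x. poly h x = 0} = S"
    using common h(3,4) unfolding pS[symmetric, abs_def] set_eq_iff by (auto elim!: dvdE)
  have "rsquarefree p"
    unfolding p_def by (rule rsquarefree_of_int_prime_elem[OF P])
  \<comment> \<open>As a divisor of the squarefree \<open>p\<close>, \<open>h\<close> is determined
    by its root set up to a constant.\<close>
  then have "rsquarefree h"
    using h(2,3) \<open>p \<noteq> 0\<close> dvd_imp_order_le[OF \<open>p \<noteq> 0\<close> h(3)] unfolding rsquarefree_def
    by (metis le_zero_eq le_Suc_eq One_nat_def)
  then have h_eq: "smult (lead_coeff h) (\<Prod>z\<in>S. [:- z, 1:]) = h"
    using complex_poly_decompose_rsquarefree[of h] by (simp add: hS)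
  have "(\<Prod>z\<in>S. [:- z, 1:]) = smult (1 / lead_coeff h) (smult (lead_coeff h) (\<Prod>z\<in>S. [:- z, 1:]))"
    using h(2) by simp
  also have "\<dots> = smult (1 / lead_coeff h) h"
    unfolding h_eq ..
  also have "\<dots> \<in> rat_gen.polys (b ^ n)"
    using h(1) by (intro rat_gen.polys_smult rat_gen.divide_mem rat_gen.one_mem) (auto simp: rat_gen.polys_def)
  finally have "(\<Prod>z\<in>#mset_set S. [:- z, 1:]) \<in> rat_gen.polys (b ^ n)"
    using fin by (simp add: prod_unfold_prod_mset)
  then have "(\<Prod>z\<in>#mset_set S. poly (map_poly of_int f) z) \<in> rat_gen (b ^ n)"
    by (rule rat_gen.prod_roots_mem) (rule rat_gen.polys_of_int)
  then show ?thesis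
    using fin by (simp add: prod_unfold_prod_mset S_def ev_def)
qed

text \<open>The \<open>t\<close>-th root of the product is the relative norm of \<open>x\<close>.\<close>

lemma prod_fibre_root:
  assumes b: "algebraic b" and x: "x \<in> rat_gen b" "x ^ t = b"
  obtains y where "y \<in> rat_gen (b ^ n)" "y ^ t = \<Prod>{r \<in> conjugates b. r ^ n = b ^ n}"
proof -
  define S where "S = {r \<in> conjugates b. r ^ n = b ^ n}"
  obtain f g where fg: "ev g b \<noteq> 0" "x = ev f b / ev g b"
    using x(1) by (rule rat_genE)
  have S: "(ev f r / ev g r) ^ t = r" if "r \<in> S" for r
  proof -
    have r: "r \<in> conjugates b"
      using that by (simp add: S_def)
    have "ev g r \<noteq> 0"
      using fg(1) conjugates_eq[OF b r] conjugates_refl[of b] by (metis conjugatesD)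
    \<comment> \<open>Cleared of denominators, \<open>x ^ t = b\<close> is an integer polynomial
      relation for \<open>b\<close>, so it passes to every conjugate \<open>r\<close>.\<close>
    moreover have "ev (f ^ t - monom 1 1 * g ^ t) b = 0"
    proof -
      have "ev f b = x * ev g b"
        using fg by simp
      then have "ev f b ^ t = b * ev g b ^ t"
        by (simp only: power_mult_distrib x(2))
      then show ?thesis
        by simp
    qed
    then have "ev (f ^ t - monom 1 1 * g ^ t) r = 0"
      using r conjugatesD by blast
    ultimately show ?thesis
      by (simp add: power_divide field_simps)
  qed
  define y where "y = (\<Prod>r\<in>S. ev f r) / (\<Prod>r\<in>S. ev g r)"
  have "y \<in> rat_gen (b ^ n)"
    unfolding y_def S_def by (intro rat_gen.divide_mem prod_fibre_mem b)
  moreover have "y ^ t = (\<Prod>r\<in>S. (ev f r / ev g r) ^ t)"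
    unfolding y_def prod_dividef[symmetric] prod_power_distrib ..
  then have "y ^ t = \<Prod>S"
    by (simp add: S)
  ultimately show ?thesis
    using that by (simp add: S_def)
qed

section \<open>Degrees of roots\<close>

definition degree_val :: "nat \<Rightarrow> complex \<Rightarrow> nat" where
  "degree_val p b = multiplicity p (card (conjugates b))"

lemma fibre_card_le:
  assumes "n > 0" "b \<noteq> 0"
  shows "card {r \<in> conjugates b. r ^ n = b ^ n} \<le> n"
proof -
  have "card {r \<in> conjugates b. r ^ n = b ^ n} \<le> card {r. r ^ n = b ^ n}"
    using assms by (intro card_mono) (auto simp: finite_nth_roots)
  then show ?thesis
    using assms by (simp add: card_nth_roots)
qed

lemma fibre_card_pos:
  assumes "algebraic b"
  shows "card {r \<in> conjugates b. r ^ n = b ^ n} > 0"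
  using finite_conjugates_algebraic[OF assms] by (auto simp: card_gt_0_iff)

lemma degree_val_power_le:
  assumes "algebraic b" "n > 0"
  shows "degree_val p (b ^ n) \<le> degree_val p b"
  unfolding degree_val_def using card_conjugates_power_dvd[OF assms] card_conjugates_pos[OF assms(1)]
  by (intro dvd_imp_multiplicity_le) auto

text \<open>With \<open>r * u = q * v + 1\<close>, the quotient \<open>y ^ u / a ^ v\<close> is the
  required root.\<close>

lemma power_root_of_coprime_power:
  assumes K: "complex_subfield K" and aK: "a \<in> K" "y \<in> K" and "a \<noteq> 0"
    and eq: "a ^ r = y ^ q" and "coprime r q" "r > 0"
  shows "\<exists>c\<in>K. c ^ q = a"
proof -
  interpret complex_subfield K
    by (rule K)
  obtain u v where uv: "r * u = q * v + 1"
    using bezout_nat[of r q] assms by auto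
  have "a * (a ^ v) ^ q = a ^ (r * u)"
    unfolding uv by (simp add: power_mult[symmetric] mult.commute)
  also have "\<dots> = (y ^ u) ^ q"
    unfolding power_mult eq by (simp add: power_mult[symmetric] mult.commute)
  finally have "(y ^ u / a ^ v) ^ q = a"
    using \<open>a \<noteq> 0\<close> by (simp add: power_divide field_simps)
  then show ?thesis
    using aK by (intro bexI[of _ "y ^ u / a ^ v"] divide_mem power_mem)
qed

text \<open>Both cases take the relative norm of a root of \<open>b ^ p ^ k\<close>. Oddness of \<open>p\<close> is what makes the product
  of all \<open>p\<close>-th roots of \<open>a\<close> equal to \<open>a\<close>; for \<open>p = 2\<close> the statement fails (\<open>b = 1 + \<i>\<close>, \<open>b ^ 4 = -4\<close>).\<close>

lemma odd_prime_power_root: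
  assumes p: "prime p" "odd p" and b: "algebraic b" "b \<noteq> 0"
    and g: "degree_val p b \<le> degree_val p (b ^ p ^ k) + g"
  shows "\<exists>c\<in>rat_gen (b ^ p ^ k). c ^ p ^ (k - g) = b ^ p ^ k"
  using g
proof (induction k arbitrary: g)
  case 0
  then show ?case
    by (auto intro: self_mem_rat_gen)
next
  case (Suc k)
  define b1 where "b1 = b ^ p ^ k"
  define a where "a = b ^ p ^ Suc k"
  have a: "a = b1 ^ p"
    by (simp add: a_def b1_def power_mult[symmetric] mult.commute)
  have p0: "p > 0"
    using p by (simp add: prime_gt_0_nat)
  have b1: "algebraic b1" "b1 \<noteq> 0"
    using b p0 by (auto simp: b1_def intro: algebraic_power)
  have "a \<noteq> 0"
    using b by (simp add: a_def)
  define S where "S = {r \<in> conjugates b1. r ^ p = b1 ^ p}"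
  define r where "r = card S"
  have r: "r > 0" "r \<le> p"
    using fibre_card_le[OF p0 b1(2)] fibre_card_pos[OF b1(1)] by (auto simp: r_def S_def)
  have deg: "card (conjugates b1) = r * card (conjugates a)"
    unfolding r_def S_def a by (rule card_conjugates_power[OF b1(1) p0])
  have val: "degree_val p b1 = multiplicity p r + degree_val p a"
    unfolding degree_val_def deg using r p card_conjugates_pos[OF algebraic_power[OF b1(1) p0]]
    by (subst prime_elem_multiplicity_mult_distrib) (auto simp: a)
  \<comment> \<open>The part of the allowance \<open>g\<close> spent between \<open>b\<close> and
    \<open>b1\<close>; the step from \<open>b1\<close> to \<open>a\<close> costs 1 more exactly when
    the fibre is full.\<close>
  define g1 where "g1 = degree_val p b - degree_val p b1"
  have g1: "degree_val p b = degree_val p b1 + g1"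
    using degree_val_power_le[OF b(1), of "p ^ k" p] p0 by (simp add: g1_def b1_def)
  obtain x where x: "x \<in> rat_gen b1" "x ^ p ^ (k - g1) = b1"
    using Suc.IH[of g1] g1 unfolding b1_def by auto
  obtain y where y: "y \<in> rat_gen a" "y ^ p ^ (k - g1) = \<Prod>S"
    using prod_fibre_root[OF b1(1) x, of p] unfolding a S_def by blast
  show ?case
  proof (cases "r = p")
    case True
    \<comment> \<open>A full fibre contains all \<open>p\<close>-th roots of \<open>a\<close>, whose
      product is \<open>a\<close>, so \<open>y\<close> is a root of \<open>a\<close> itself. Its
      exponent suffices because \<open>g1 < g\<close> here.\<close>
    have S: "S = {r. r ^ p = a}"
    proof (rule card_subset_eq)
      show "finite {r. r ^ p = a}"
        using p0 by (rule finite_nth_roots)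
      show "card S = card {r. r ^ p = a}"
        using True p0 \<open>a \<noteq> 0\<close> by (simp add: r_def card_nth_roots)
    qed (auto simp: S_def a)
    have "(\<Prod>z\<in>{z. z ^ p = a}. 0 - z) = 0 ^ p - a"
      using p0 \<open>a \<noteq> 0\<close> by (rule prod_nth_roots_diff)
    moreover have "(\<Prod>z\<in>{z. z ^ p = a}. 0 - z) = (- 1) ^ p * \<Prod>S"
      using p0 \<open>a \<noteq> 0\<close> unfolding S
      by (simp add: prod_uminus card_nth_roots)
    ultimately have "\<Prod>S = a"
      using p p0 by (simp add: power_0_left)
    have "multiplicity p p = 1"
      using p by (intro multiplicity_prime) auto
    then have "k - g1 = (k - g1 - (Suc k - g)) + (Suc k - g)"
      using Suc.prems g1 val True by (simp add: a_def)
    then have "(y ^ p ^ (k - g1 - (Suc k - g))) ^ p ^ (Suc k - g) = a"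
      using y \<open>\<Prod>S = a\<close> by (metis power_add power_mult)
    with y show ?thesis
      unfolding a_def[symmetric] by (intro bexI[of _ "y ^ p ^ (k - g1 - (Suc k - g))"] rat_gen.power_mem)
  next
    case False
    with r have "r < p"
      by simp
    then have "\<not> p dvd r"
      using r by (auto dest: dvd_imp_le)
    then have cop: "coprime r p"
      using p prime_imp_coprime by (metis coprime_commute)
    have "multiplicity p r = 0"
      using \<open>\<not> p dvd r\<close> by (rule not_dvd_imp_multiplicity_0)
    then have e: "Suc (k - g1) = (Suc (k - g1) - (Suc k - g)) + (Suc k - g)"
      using Suc.prems g1 val by (simp add: a_def)
    define z where "z = y ^ p ^ (Suc (k - g1) - (Suc k - g))"
    \<comment> \<open>A smaller fibre has size \<open>r\<close> prime to \<open>p\<close>. The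
      \<open>p\<close>-th power of its product is \<open>a ^ r\<close>, and the exponent
      \<open>r\<close> is then removed by Bezout.\<close>
    have "a ^ r = (\<Prod>S) ^ p"
      unfolding prod_power_distrib by (simp add: S_def a r_def)
    also have "\<dots> = y ^ p ^ Suc (k - g1)"
      unfolding y(2)[symmetric] by (simp add: power_mult[symmetric] mult.commute)
    also have "\<dots> = z ^ p ^ (Suc k - g)"
      unfolding z_def by (subst e) (simp only: power_add power_mult)
    finally show ?thesis
      unfolding a_def[symmetric] using y(1) cop r(1) \<open>a \<noteq> 0\<close>
      by (intro power_root_of_coprime_power[of "rat_gen a" a z r] rat_gen.complex_subfield_axioms
          self_mem_rat_gen) (auto simp: z_def intro: rat_gen.power_mem)
  qed
qed

text \<open>Each of the \<open>k\<close> squarings has a fibre of size 1 or 2.\<close>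

lemma two_power_degree:
  assumes "algebraic b" "b \<noteq> 0"
  shows "\<exists>j. card (conjugates b) = 2 ^ j * card (conjugates (b ^ 2 ^ k))"
proof (induction k)
  case 0
  show ?case
    by (intro exI[of _ 0]) simp
next
  case (Suc k)
  then obtain j where j: "card (conjugates b) = 2 ^ j * card (conjugates (b ^ 2 ^ k))" ..
  define c where "c = b ^ 2 ^ k"
  have c: "algebraic c" "c \<noteq> 0"
    using assms by (auto simp: c_def intro: algebraic_power)
  define r where "r = card {r \<in> conjugates c. r ^ 2 = c ^ 2}"
  have "r > 0" "r \<le> 2"
    using fibre_card_le[of 2 c] fibre_card_pos[of c 2] c by (auto simp: r_def)
  then have "r = 2 ^ 0 \<or> r = 2 ^ 1"
    by auto
  moreover have "card (conjugates c) = r * card (conjugates (c ^ 2))"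
    unfolding r_def using c by (intro card_conjugates_power) auto
  moreover have "c ^ 2 = b ^ 2 ^ Suc k"
    by (simp add: c_def power_mult[symmetric] mult.commute)
  ultimately have "card (conjugates b) = 2 ^ (j + 0) * card (conjugates (b ^ 2 ^ Suc k)) \<or>
      card (conjugates b) = 2 ^ (j + 1) * card (conjugates (b ^ 2 ^ Suc k))"
    using j unfolding c_def[symmetric] by auto
  then show ?case
    by blast
qed

text \<open>Dividing out \<open>card (conjugates a)\<close> makes \<open>d\<close> the degree of
  Q(x) over Q(a). The clause on prime factors is what makes the values for coprime exponents
  coprime.\<close>

definition minimal_root :: "nat \<Rightarrow> complex \<Rightarrow> complex \<Rightarrow> nat \<Rightarrow> bool" where
  "minimal_root n a x d \<longleftrightarrow> x ^ n = a \<and> card (conjugates x) = d * card (conjugates a) \<and>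
     (\<forall>p. prime p \<longrightarrow> p dvd d \<longrightarrow> p dvd n) \<and>
     (\<forall>b. b ^ n = a \<longrightarrow> d * card (conjugates a) dvd card (conjugates b))"

text \<open>Let \<open>p ^ g\<close> be the \<open>p\<close>-part of the relative degree of a root
  \<open>b\<close> where this part is least. Then \<open>p ^ g\<close> divides every relative
  degree, and it remains to find a root attaining it.\<close>

lemma minimal_root_prime_power:
  assumes p: "prime p" and a: "algebraic a" "a \<noteq> 0" and k: "k > 0"
  shows "\<exists>x d. minimal_root (p ^ k) a x d"
proof -
  define q where "q = p ^ k"
  have q0: "q > 0"
    using p by (simp add: q_def prime_gt_0_nat)
  have root: "algebraic b" "b \<noteq> 0" "card (conjugates a) dvd card (conjugates b)" if "b ^ q = a" for b
    using that a q0 algebraic_root[of b q] card_conjugates_power_dvd[of b q] by auto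
  have ca: "card (conjugates a) > 0"
    using a(1) by (rule card_conjugates_pos)
  have pdvd: "\<forall>r. prime r \<longrightarrow> r dvd p ^ j \<longrightarrow> r dvd q" for j
    using p k prime_dvd_power primes_dvd_imp_eq unfolding q_def by (metis dvd_power)
  obtain b0 where b0: "b0 ^ q = a"
    using nth_root_exists[OF q0] by blast
  have "\<exists>b. b ^ q = a \<and> (\<forall>c. c ^ q = a \<longrightarrow> degree_val p b \<le> degree_val p c)"
    using ex_has_least_nat[of "\<lambda>b. b ^ q = a" b0 "degree_val p"] b0 by blast
  then obtain b where b: "b ^ q = a" and least: "\<And>c. c ^ q = a \<Longrightarrow> degree_val p b \<le> degree_val p c"
    by blast
  define g where "g = degree_val p b - degree_val p a"
  have "degree_val p a \<le> degree_val p b"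
    using degree_val_power_le[of b q p] root(1)[OF b] q0 b by simp
  then have g: "degree_val p b = degree_val p a + g"
    by (simp add: g_def)
  have dvd: "p ^ g * card (conjugates a) dvd card (conjugates c)" if c: "c ^ q = a" for c
  proof -
    obtain s where s: "card (conjugates c) = card (conjugates a) * s"
      using root(3)[OF c] by auto
    then have "s > 0"
      using card_conjugates_pos[OF root(1)[OF c]] by (intro gr0I) auto
    then have "degree_val p c = degree_val p a + multiplicity p s"
      unfolding degree_val_def s using p ca by (subst prime_elem_multiplicity_mult_distrib) auto
    with least[OF c] g have "g \<le> multiplicity p s"
      by simp
    then have "p ^ g dvd s"
      by (rule multiplicity_dvd')
    then show ?thesis
      unfolding s by (simp add: mult.commute)
  qed
  have "\<exists>x. x ^ q = a \<and> card (conjugates x) = p ^ g * card (conjugates a)"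
  proof (cases "p = 2")
    case True
    \<comment> \<open>The relative degree of \<open>b\<close> is a power of 2, so it equals its own
      2-part and \<open>b\<close> attains the minimum.\<close>
    obtain j where j: "card (conjugates b) = 2 ^ j * card (conjugates a)"
      using two_power_degree[OF root(1,2)[OF b], of k] b True by (auto simp: q_def)
    then have "degree_val p b = j + degree_val p a"
      unfolding degree_val_def j using ca True
      by (subst prime_elem_multiplicity_mult_distrib) auto
    with g j b True show ?thesis
      by (intro exI[of _ b]) simp
  next
    case False
    then have odd: "odd p"
      using p by (metis prime_odd_nat prime_ge_2_nat le_neq_implies_less)
    obtain c where c: "c \<in> rat_gen a" "c ^ p ^ (k - g) = a"
      using odd_prime_power_root[OF p odd root(1,2)[OF b], of k g] g b by (auto simp: q_def)
    have "c \<noteq> 0"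
      using c(2) a(2) p by (auto simp: prime_gt_0_nat power_0_left split: if_splits)
    have pk: "p ^ (k - g) > 0" "p ^ g > 0"
      using p by (auto simp: prime_gt_0_nat)
    have algc: "algebraic c"
      using c(2) a(1) pk algebraic_root[of c] by metis
    \<comment> \<open>Here Q(c) = Q(a): \<open>a\<close> is a power of \<open>c\<close>, and the
      expression of \<open>c\<close> in terms of \<open>a\<close> forces the fibre of
      \<open>c\<close> over \<open>a\<close> to be a singleton.\<close>
    have cc: "card (conjugates c) = card (conjugates a)"
    proof -
      obtain f h where fh: "ev h a \<noteq> 0" "c = ev f a / ev h a"
        using c(1) by (rule rat_genE)
      define F where "F = monom 1 1 * pcompose h (monom 1 (p ^ (k - g))) - pcompose f (monom 1 (p ^ (k - g)))"
      have F: "ev F z = z * ev h (z ^ p ^ (k - g)) - ev f (z ^ p ^ (k - g))" for z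
        by (simp add: F_def)
      have "r = c" if "r \<in> conjugates c" "r ^ p ^ (k - g) = c ^ p ^ (k - g)" for r
      proof -
        have "c * ev h a = ev f a"
          using fh by simp
        then have "ev F c = 0"
          by (simp add: F c(2))
        then have "ev F r = 0"
          using that(1) conjugatesD by blast
        then have "r * ev h a = ev f a"
          using that(2) by (simp add: F c(2))
        with \<open>c * ev h a = ev f a\<close> fh(1) show ?thesis
          by (metis mult_right_cancel)
      qed
      then have "{r \<in> conjugates c. r ^ p ^ (k - g) = c ^ p ^ (k - g)} = {c}"
        by auto
      then show ?thesis
        using card_conjugates_power[OF algc pk(1)] c(2) by simp
    qed
    \<comment> \<open>The fibre of \<open>b\<close> over \<open>a\<close> has at most
      \<open>p ^ k\<close> elements, and \<open>p ^ g\<close> divides its size.\<close>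
    have gk: "g \<le> k"
    proof (rule ccontr)
      assume "\<not> g \<le> k"
      then have "q < p ^ g"
        using p unfolding q_def by (intro power_strict_increasing) (auto simp: prime_gt_Suc_0_nat)
      define s where "s = card {r \<in> conjugates b. r ^ q = b ^ q}"
      have s: "s > 0" "s \<le> q"
        using fibre_card_le[OF q0] fibre_card_pos root[OF b] by (auto simp: s_def)
      have "card (conjugates b) = s * card (conjugates a)"
        using card_conjugates_power[OF root(1)[OF b] q0] b by (simp add: s_def)
      with dvd[OF b] ca have "p ^ g dvd s"
        by simp
      with s \<open>q < p ^ g\<close> show False
        by (auto dest: dvd_imp_le)
    qed
    obtain x where x: "x ^ p ^ g = c"
      using nth_root_exists[OF pk(2)] by blast
    have xq: "x ^ q = a"
    proof -
      have "q = p ^ g * p ^ (k - g)"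
        using gk by (simp add: q_def power_add[symmetric])
      then show ?thesis
        by (simp only: power_mult x c(2))
    qed
    \<comment> \<open>Over Q(c) = Q(a), the degree of \<open>x\<close> is at most
      \<open>p ^ g\<close> and also a multiple of \<open>p ^ g\<close>.\<close>
    define s where "s = card {r \<in> conjugates x. r ^ p ^ g = x ^ p ^ g}"
    have s: "s > 0" "s \<le> p ^ g"
      using fibre_card_le[OF pk(2)] fibre_card_pos root[OF xq] by (auto simp: s_def)
    have cx: "card (conjugates x) = s * card (conjugates a)"
      using card_conjugates_power[OF root(1)[OF xq] pk(2)] x cc by (simp add: s_def)
    with dvd[OF xq] ca have "p ^ g dvd s"
      by simp
    with s have "s = p ^ g"
      by (auto dest: dvd_imp_le)
    with cx xq show ?thesis
      by blast
  qed
  then show ?thesis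
    using dvd pdvd[of g] unfolding minimal_root_def q_def by blast
qed

text \<open>Bezout combines \<open>x\<close> and \<open>y\<close> into one root \<open>z\<close>
  with \<open>z ^ n = x\<close> and \<open>z ^ m = y\<close>. Its relative degree is a multiple of
  the coprime \<open>d\<close> and \<open>e\<close>, and it is at most \<open>d * e\<close> because
  the fibre of \<open>z\<close> over \<open>x\<close> embeds into that of \<open>y\<close> over
  \<open>a\<close>.\<close>

lemma minimal_root_mult:
  assumes m: "m > 0" and n: "n > 0" and cop: "coprime m n" and a: "algebraic a" "a \<noteq> 0"
    and x: "minimal_root m a x d" and y: "minimal_root n a y e"
  shows "coprime d e" "\<exists>z. minimal_root (m * n) a z (d * e)"
proof -
  have x': "x ^ m = a" "card (conjugates x) = d * card (conjugates a)" "\<And>p. prime p \<Longrightarrow> p dvd d \<Longrightarrow> p dvd m"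
      "\<And>b. b ^ m = a \<Longrightarrow> d * card (conjugates a) dvd card (conjugates b)"
    using x unfolding minimal_root_def by auto
  have y': "y ^ n = a" "card (conjugates y) = e * card (conjugates a)" "\<And>p. prime p \<Longrightarrow> p dvd e \<Longrightarrow> p dvd n"
      "\<And>b. b ^ n = a \<Longrightarrow> e * card (conjugates a) dvd card (conjugates b)"
    using y unfolding minimal_root_def by auto
  show de: "coprime d e"
  proof (rule ccontr)
    assume "\<not> coprime d e"
    then obtain p where p: "prime p" "p dvd d" "p dvd e"
      using prime_factor_nat[of "gcd d e"] by (auto simp: coprime_iff_gcd_eq_1)
    then have "p dvd m" "p dvd n"
      using x'(3) y'(3) by blast+
    with cop p(1) show False
      using coprime_common_divisor not_prime_unit by blast
  qed
  have ca: "card (conjugates a) > 0"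
    using a(1) by (rule card_conjugates_pos)
  obtain u v where uv: "n * u = m * v + 1"
    using bezout_nat[of n m] n cop by (auto simp: coprime_iff_gcd_eq_1 gcd.commute)
  have nz: "x \<noteq> 0" "y \<noteq> 0"
    using x'(1) y'(1) a(2) m n by (auto simp: power_0_left)
  define z where "z = x ^ u / y ^ v"
  have "z ^ n = x ^ (n * u) / y ^ (n * v)"
    by (simp add: z_def power_divide power_mult[symmetric] mult.commute)
  also have "\<dots> = x ^ (m * v) * x / y ^ (n * v)"
    by (simp add: uv)
  also have "\<dots> = x"
    using a(2) by (simp add: power_mult x'(1) y'(1))
  finally have zn: "z ^ n = x" .
  have "z ^ m = x ^ (m * u) / y ^ (m * v)"
    by (simp add: z_def power_divide power_mult[symmetric] mult.commute)
  also have "\<dots> = y ^ (n * u) / y ^ (m * v)"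
    by (simp add: power_mult x'(1) y'(1))
  also have "\<dots> = y"
    using nz by (simp add: uv)
  finally have zm: "z ^ m = y" .
  have zmn: "z ^ (m * n) = a"
    by (simp add: power_mult zm y'(1))
  have div: "d * e * card (conjugates a) dvd card (conjugates b)" if b: "b ^ (m * n) = a" for b
  proof -
    have alg: "algebraic b"
      using algebraic_root[of b "m * n"] a(1) b m n by simp
    \<comment> \<open>These powers of \<open>b\<close> are roots of \<open>a\<close> for the two
      exponents, and their degrees divide that of \<open>b\<close>.\<close>
    have "(b ^ n) ^ m = a" "(b ^ m) ^ n = a"
      using b by (simp_all add: power_mult[symmetric] mult.commute)
    then have dvd: "d * card (conjugates a) dvd card (conjugates b)" "e * card (conjugates a) dvd card (conjugates b)"
      using x'(4) y'(4) card_conjugates_power_dvd[OF alg] m n dvd_trans by blast+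
    from dvd(1) obtain k where k: "card (conjugates b) = d * card (conjugates a) * k"
      by (elim dvdE)
    from dvd(2) have "card (conjugates a) * e dvd card (conjugates a) * (d * k)"
      unfolding k by (simp only: mult_ac)
    then have "e dvd d * k"
      using ca by simp
    then have "e dvd k"
      using de by (simp add: coprime_dvd_mult_right_iff coprime_commute)
    then show ?thesis
      unfolding k by (auto simp: mult_ac)
  qed
  have algz: "algebraic z"
    using algebraic_root[of z "m * n"] a(1) zmn m n by simp
  have algy: "algebraic y"
    using algebraic_root[of y n] a(1) y'(1) n by simp
  define S where "S = {r \<in> conjugates z. r ^ n = z ^ n}"
  define T where "T = {r \<in> conjugates y. r ^ n = y ^ n}"
  have fin: "finite T"
    using finite_conjugates_algebraic[OF algy] by (simp add: T_def)
  have "card (conjugates y) = card T * card (conjugates a)"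
    using card_conjugates_power[OF algy n] by (simp add: T_def y'(1))
  then have "card T = e"
    using y'(2) ca by simp
  have "card S \<le> card T"
  proof (rule card_inj_on_le[OF _ _ fin])
    show "(\<lambda>r. r ^ m) ` S \<subseteq> T"
    proof safe
      fix r assume "r \<in> S"
      then have "r \<in> conjugates z" "r ^ n = x"
        by (auto simp: S_def zn)
      then have "r ^ m \<in> conjugates (z ^ m)" "(r ^ m) ^ n = a"
        using conjugates_power x'(1) by (auto simp: power_mult[symmetric] mult.commute[of m n])
      then show "r ^ m \<in> T"
        by (simp add: T_def zm y'(1))
    qed
    \<comment> \<open>An element \<open>r\<close> of the fibre is recovered from
      \<open>r ^ m\<close> by \<open>r ^ (m * v) * r = x ^ u\<close>.\<close>
    show "inj_on (\<lambda>r. r ^ m) S"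
    proof (rule inj_onI)
      fix r s assume rs: "r \<in> S" "s \<in> S" "r ^ m = s ^ m"
      then have "r ^ n = x" "s ^ n = x"
        by (auto simp: S_def zn)
      have "t ^ (m * v) * t = x ^ u" if "t ^ n = x" for t
      proof -
        have "t ^ (m * v) * t = t ^ (n * u)"
          by (simp add: uv)
        then show ?thesis
          by (simp add: power_mult that)
      qed
      then have "(s ^ m) ^ v * r = (s ^ m) ^ v * s"
        using \<open>r ^ n = x\<close> \<open>s ^ n = x\<close> rs(3) by (metis power_mult)
      moreover have "s \<noteq> 0"
        using \<open>s ^ n = x\<close> nz n by auto
      ultimately show "r = s"
        by simp
    qed
  qed
  then have "card (conjugates z) \<le> d * e * card (conjugates a)"
    using card_conjugates_power[OF algz n] x'(2) \<open>card T = e\<close> ca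
    by (simp add: S_def zn mult_ac)
  then have "card (conjugates z) = d * e * card (conjugates a)"
    using div[OF zmn] card_conjugates_pos[OF algz] by (auto dest: dvd_imp_le)
  moreover have "p dvd m * n" if "prime p" "p dvd d * e" for p
    using that x'(3) y'(3) prime_dvd_multD[OF that] by (auto intro: dvd_mult dvd_mult2)
  ultimately show "\<exists>z. minimal_root (m * n) a z (d * e)"
    using zmn div unfolding minimal_root_def by blast
qed

lemma minimal_root_exists:
  assumes "algebraic a" "a \<noteq> 0" "n > 0"
  shows "\<exists>x d. minimal_root n a x d"
  using assms(3)
proof (induction n rule: less_induct)
  case (less n)
  show ?case
  proof (cases "n = 1")
    case True
    then show ?thesis
      by (intro exI[of _ a] exI[of _ 1]) (auto simp: minimal_root_def)
  next
    case False
    then obtain p where p: "prime p" "p dvd n"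
      using prime_factor_nat by blast
    define k where "k = multiplicity p n"
    obtain l where l: "n = p ^ k * l" "\<not> p dvd l"
      using multiplicity_decompose'[of n p] less.prems p(1) unfolding k_def by (metis not_prime_unit less_numeral_extra(3))
    have "k > 0"
      using p less.prems by (simp add: k_def prime_multiplicity_gt_zero_iff)
    have "l > 0"
      using l(1) less.prems by (intro gr0I) auto
    have "p ^ k > 1"
      using one_less_power[OF prime_gt_1_nat[OF p(1)] \<open>k > 0\<close>] .
    then have "l < n"
      using \<open>l > 0\<close> l(1) by simp
    then obtain y e where y: "minimal_root l a y e"
      using less.IH \<open>l > 0\<close> by blast
    obtain x d where x: "minimal_root (p ^ k) a x d"
      using minimal_root_prime_power[OF p(1) assms(1,2) \<open>k > 0\<close>] by blast
    have "coprime (p ^ k) l"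
      using p(1) l(2) by (simp add: prime_imp_coprime)
    then have "\<exists>z. minimal_root n a z (d * e)"
      unfolding l(1) using p(1) \<open>l > 0\<close>
      by (intro minimal_root_mult(2)[OF _ _ _ assms(1,2) x y]) (auto simp: prime_gt_0_nat)
    then show ?thesis
      by blast
  qed
qed

section \<open>Local characterization of the Hartley condition\<close>

lemma root_norm_is_unit:
  assumes "n > 0" "is_unit g"
  shows "is_unit (root_norm n g)"
proof -
  obtain h where "1 = g * h"
    using assms(2) by auto
  then have "1 = root_norm n g * root_norm n h"
    using assms(1) by (simp add: root_norm_mult[symmetric] flip: \<open>1 = g * h\<close>)
  then show ?thesis
    by (rule dvdI)
qed

text \<open>Norms are multiplicative, so irreducible factors \<open>Q\<close> of \<open>g\<close>
  suffice. If \<open>P\<close> divides the norm of \<open>Q\<close>, then \<open>Q\<close> has a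
  root \<open>r\<close> with \<open>r ^ n = a\<close>, and the multiplicity is the degree of Q(r)
  over Q(a), a multiple of \<open>d\<close>.\<close>

lemma minimal_root_dvd_multiplicity:
  assumes x: "minimal_root n a x d" and n: "n > 0" and P: "prime_elem P" "ev P a = 0" and g: "content g = 1"
  shows "d dvd multiplicity P (root_norm n g)"
  using g
proof (induction g rule: prime_divisors_induct)
  case zero
  then show ?case by simp
next
  case (unit g)
  then have "multiplicity P (root_norm n g) = 0"
    using root_norm_is_unit[OF n] by (simp add: multiplicity_unit_right)
  then show ?case by simp
next
  case (factor Q g)
  have Q: "prime_elem Q"
    using factor.hyps by (rule prime_imp_prime_elem)
  have cont: "content Q = 1" "content g = 1"
  proof -
    have "content Q * content g = 1"
      using factor.prems by (simp add: content_mult)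
    then show "content Q = 1" "content g = 1"
      by (metis dvd_triv_left dvd_triv_right is_unit_content_iff)+
  qed
  have nz: "Q \<noteq> 0" "g \<noteq> 0"
    using cont by auto
  have "d dvd multiplicity P (root_norm n Q)"
  proof (cases "P dvd root_norm n Q")
    case True
    then have "ev (root_norm n Q) a = 0"
      using P(2) by (auto elim!: dvdE)
    then obtain r where r: "a = r ^ n" "ev Q r = 0"
      using ev_root_norm_eq_0D[OF n nz(1)] by blast
    then have Pr: "ev P (r ^ n) = 0"
      using P(2) by simp
    define s where "s = card {t \<in> conjugates r. t ^ n = r ^ n}"
    obtain u where u: "is_unit u" "root_norm n Q = u * P ^ s"
      unfolding s_def by (rule root_norm_prime_elem[OF Q r(2) P(1) Pr n])
    have "multiplicity P (root_norm n Q) = s"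
      unfolding u(2) using P(1) u(1)
      by (simp add: multiplicity_times_unit_right prime_elem_not_unit multiplicity_same_power)
    moreover have "d * card (conjugates a) dvd card (conjugates r)"
      using x r(1) by (simp add: minimal_root_def)
    moreover have alg: "algebraic r"
      unfolding algebraic_iff_ev using nz(1) r(2) by blast
    moreover have "card (conjugates r) = s * card (conjugates a)"
      unfolding r(1) s_def by (rule card_conjugates_power[OF alg n])
    moreover have "card (conjugates a) > 0"
      unfolding r(1) by (intro card_conjugates_pos algebraic_power alg n)
    ultimately show ?thesis
      by simp
  next
    case False
    then show ?thesis
      by (simp add: not_dvd_imp_multiplicity_0)
  qed
  moreover have "multiplicity P (root_norm n (Q * g)) = multiplicity P (root_norm n Q) + multiplicity P (root_norm n g)"
    unfolding root_norm_mult[OF n] using P(1) nz n by (intro prime_elem_multiplicity_mult_distrib) auto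
  ultimately show ?case
    using factor.IH cont(2) by simp
qed

lemma is_unit_int_poly_iff: "is_unit (u :: int poly) \<longleftrightarrow> u = 1 \<or> u = - 1"
proof
  assume "is_unit u"
  then obtain c where "u = [:c:]" "is_unit c"
    by (auto simp: is_unit_poly_iff)
  then show "u = 1 \<or> u = - 1"
    by (auto simp: abs_if one_pCons split: if_splits)
qed auto

lemma hartley_unit: "n > 0 \<Longrightarrow> is_unit u \<Longrightarrow> hartley n u"
  by (auto simp: is_unit_int_poly_iff hartley_uminus)

lemma hartley_unit_mult:
  assumes "n > 0" "is_unit u" "hartley n (u * D)"
  shows "hartley n D"
proof -
  obtain v where "1 = u * v"
    using assms(2) by auto
  then have "is_unit v"
    by (metis dvd_triv_right)
  then have "hartley n (v * (u * D))"
    using assms by (blast intro: hartley_mult hartley_unit)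
  moreover have "v * (u * D) = D"
    using \<open>1 = u * v\<close> by (metis mult.assoc mult.commute mult_1)
  ultimately show ?thesis
    by simp
qed

lemma hartley_power: "n > 0 \<Longrightarrow> hartley n D \<Longrightarrow> hartley n (D ^ k)"
  by (induction k) (auto intro: hartley_mult)

lemma hartley_prod: "n > 0 \<Longrightarrow> (\<And>i. i \<in> A \<Longrightarrow> hartley n (f i)) \<Longrightarrow> hartley n (\<Prod>i\<in>A. f i)"
  by (induction A rule: infinite_finite_induct) (auto intro: hartley_mult)

lemma hartley_root_norm: "n > 0 \<Longrightarrow> hartley n (root_norm n g)"
  by (auto simp: hartley_iff_root_norm)

text \<open>As 0 is its own only \<open>n\<close>-th root, the norm of \<open>P\<close> is
  \<open>P\<close> up to a unit. This covers the root excluded in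
  \<open>minimal_root_exists\<close>.\<close>

lemma hartley_prime_elem_root_0:
  assumes n: "n > 0" and P: "prime_elem P" "ev P 0 = 0"
  shows "hartley n P"
proof -
  have "{r \<in> conjugates 0. r ^ n = 0 ^ n} = {0}"
    using n by (auto simp: power_0_left)
  then obtain u where "is_unit u" "root_norm n P = u * P"
    using root_norm_prime_elem[OF P P(1) _ n] P(2) n by (auto simp: power_0_left)
  then show ?thesis
    using hartley_unit_mult[OF n] hartley_root_norm[OF n, of P] by metis
qed

text \<open>The irreducible polynomial of \<open>x\<close> has norm \<open>P ^ d\<close> up to a
  unit, since the fibre of \<open>x\<close> over \<open>a\<close> has \<open>d\<close> elements;
  powers of it reach \<open>P ^ e\<close>.\<close>

lemma hartley_prime_power_of_minimal_root:
  assumes n: "n > 0" and P: "prime_elem P" "ev P a = 0" and x: "minimal_root n a x d" and "d dvd e"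
  shows "hartley n (P ^ e)"
proof -
  have algx: "algebraic x" and ca: "card (conjugates a) > 0"
  proof -
    have "algebraic a"
      unfolding algebraic_iff_ev using P by (intro exI[of _ P]) auto
    then show "algebraic x" "card (conjugates a) > 0"
      using x n algebraic_root card_conjugates_pos unfolding minimal_root_def by blast+
  qed
  obtain M where M: "prime_elem M" "ev M x = 0"
    using algx by (rule algebraic_prime_elem)
  have xn: "x ^ n = a" and "card (conjugates x) = d * card (conjugates a)"
    using x by (auto simp: minimal_root_def)
  then have "card {r \<in> conjugates x. r ^ n = x ^ n} = d"
    using card_conjugates_power[OF algx n] ca by simp
  then obtain u where u: "is_unit u" "root_norm n M = u * P ^ d"
    using root_norm_prime_elem[OF M P(1) _ n] P(2) xn by metis
  obtain k where k: "e = d * k"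
    using \<open>d dvd e\<close> by auto
  have "hartley n (u * P ^ d)"
    unfolding u(2)[symmetric] using n by (rule hartley_root_norm)
  then have "hartley n (P ^ d)"
    using hartley_unit_mult n u(1) by blast
  then show ?thesis
    unfolding k power_mult by (rule hartley_power[OF n])
qed

text \<open>The content of \<open>g\<close> leaves the norm as its \<open>n\<close>-th power, which
  then has to divide the content 1.\<close>

lemma content_eq_1_of_root_norm:
  assumes "n > 0" "D = root_norm n g \<or> D = - root_norm n g" "content D = 1"
  shows "content g = 1"
proof -
  have "content (root_norm n g) = 1"
    using assms(2,3) content_smult[of "-1" "root_norm n g"] by auto
  moreover have "root_norm n g = [:content g ^ n:] * root_norm n (primitive_part g)"
    using root_norm_mult[OF assms(1), of "[:content g:]" "primitive_part g"] assms(1) by (simp add: root_norm_const)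
  ultimately have "content ([:content g ^ n:] * root_norm n (primitive_part g)) = 1"
    by simp
  then have "is_unit (content g ^ n)"
    unfolding content_mult content_const by (metis dvd_triv_left normalize_dvd_iff)
  moreover have "content g dvd content g ^ n"
    using assms(1) by (intro dvd_power) simp
  ultimately have "is_unit (content g)"
    using dvd_trans by blast
  then show ?thesis
    by (simp only: is_unit_content_iff)
qed

theorem theorem1p6:
  fixes m n :: nat and D :: "int poly"
  assumes "m > 0" and "n > 0" and "coprime m n" and "primitive_int_poly D"
  shows "hartley (m * n) D \<longleftrightarrow> hartley m D \<and> hartley n D"
proof
  assume "hartley (m * n) D"
  then show "hartley m D \<and> hartley n D"
    using hartley_mult_left[of m n D] hartley_mult_left[of n m D] assms by (simp add: mult.commute)
next
  assume hart: "hartley m D \<and> hartley n D"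
  have mn: "m * n > 0"
    using assms by simp
  have cD: "content D = 1"
  proof (rule ccontr)
    assume "content D \<noteq> 1"
    then have "\<exists>p. prime p \<and> p dvd content D"
    proof (cases "content D = 0")
      \<comment> \<open>Content 0 means \<open>D = 0\<close>, and any prime, such as 2, divides all
        its coefficients.\<close>
      case True
      then show ?thesis
        by (intro exI[of _ 2]) simp
    next
      case False
      with \<open>content D \<noteq> 1\<close> show ?thesis
        using prime_divisor_exists[of "content D"] is_unit_content_iff by blast
    qed
    then obtain p where "prime p" "p dvd content D"
      by blast
    then show False
      using assms(4) content_dvd_coeff dvd_trans unfolding primitive_int_poly_def by blast
  qed
  then have "D \<noteq> 0"
    by auto
  \<comment> \<open>The Hartley condition is closed under products and holds for units, so the prime
    powers in \<open>D\<close> are treated one by one.\<close>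
  have "hartley (m * n) (P ^ multiplicity P D)" if P: "P \<in> prime_factors D" for P
  proof -
    have prime: "prime_elem P" and "P dvd D"
      using P by (auto intro: prime_imp_prime_elem in_prime_factors_imp_prime in_prime_factors_imp_dvd)
    have "content P dvd 1"
      using content_dvd_contentI[OF \<open>P dvd D\<close>] cD by simp
    then have cP: "content P = 1"
      by (simp only: is_unit_content_iff)
    obtain a where a: "ev P a = 0"
      using prime cP by (rule prime_elem_has_root)
    show ?thesis
    proof (cases "a = 0")
      case True
      then show ?thesis
        using hartley_prime_elem_root_0[OF mn prime] a by (intro hartley_power mn) simp
    next
      case False
      have alg: "algebraic a"
        unfolding algebraic_iff_ev using prime a by (intro exI[of _ P]) auto
      obtain x d where x: "minimal_root m a x d"
        using minimal_root_exists[OF alg False assms(1)] by blast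
      obtain y e where y: "minimal_root n a y e"
        using minimal_root_exists[OF alg False assms(2)] by blast
      note mult = minimal_root_mult[OF assms(1-3) alg False x y]
      obtain z where z: "minimal_root (m * n) a z (d * e)"
        using mult(2) by blast
      have *: "c dvd multiplicity P D" if k: "k > 0" and hk: "hartley k D" and w: "minimal_root k a w c" for k w c
      proof -
        obtain g where g: "D = root_norm k g \<or> D = - root_norm k g"
          using hk unfolding hartley_iff_root_norm[OF k] by blast
        then have "multiplicity P D = multiplicity P (root_norm k g)"
          by (auto simp: multiplicity_uminus_right)
        then show ?thesis
          using minimal_root_dvd_multiplicity[OF w k prime a content_eq_1_of_root_norm[OF k g cD]]
          by simp
      qed
      \<comment> \<open>Each condition contributes one divisor of the multiplicity; as
        \<open>d\<close> and \<open>e\<close> are coprime, their product, the degree of the minimal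
        \<open>m * n\<close>-th root, divides it too.\<close>
      have "d * e dvd multiplicity P D"
        using *[OF assms(1) _ x] *[OF assms(2) _ y] hart mult(1) by (intro divides_mult) auto
      then show ?thesis
        by (rule hartley_prime_power_of_minimal_root[OF mn prime a z])
    qed
  qed
  then have "hartley (m * n) (\<Prod>P\<in>prime_factors D. P ^ multiplicity P D)"
    using mn by (intro hartley_prod)
  also have "(\<Prod>P\<in>prime_factors D. P ^ multiplicity P D) = prod_mset (prime_factorization D)"
    unfolding prod_mset_multiplicity
    by (intro prod.cong refl) (simp add: count_prime_factorization_prime in_prime_factors_imp_prime)
  finally have hart_pf: "hartley (m * n) (prod_mset (prime_factorization D))" .
  obtain u where "is_unit u" "D = u * prod_mset (prime_factorization D)"
    using prod_mset_prime_factorization_weak[OF \<open>D \<noteq> 0\<close>, symmetric] by (rule associatedE1)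
  then show "hartley (m * n) D"
    using hartley_mult[OF mn hartley_unit[OF mn] hart_pf] by metis
qed

end
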